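(* Fix constants $0<\alpha<\frac12$, $0\le\gamma<\frac12$, $2\gamma<\gamma_q\le1$, $c_q>0$, $\sigma_0>0$, $\bar c\ge 1$. There exist positive constants $c,c_1$, depending only on these fixed constants, such that for all $n,p$, all integers $1\le k_1\le k\le c\min\{p^{\gamma},\frac{n}{\log p}\}$, and every $\xi\in\Xi(q,\bar c)$ with $q=c_q\,p^{\gamma_q}$ (the dense loading regime), $$L^*_\alpha\big(\Theta(k_1,\mathrm{I},\sigma_0),\Theta(k,\mathrm{I},\sigma_0),\xi^{\intercal}\beta\big)\;\ge\; c_1\,\|\xi\|_\infty\,\sigma_0\,\max\left\{\sqrt{k k_1}\sqrt{\frac{\log p}{n}},\ \min\left\{k\sqrt{\frac{\log p}{n}},\ \frac{\sqrt k}{n^{1/4}}\right\}\right\}.$$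
   Context: Model: one observes $Z=(Z_1,\dots,Z_n)$ with $Z_i=(y_i,X_{i\cdot})\in\mathbb{R}^{p+1}$, $y=X\beta+\epsilon$, where $X\in\mathbb{R}^{n\times p}$ has i.i.d. rows $X_{i\cdot}\sim N_p(0,\Sigma)$, independent of $\epsilon\sim N_n(0,\sigma^2 \mathrm{I})$. Let $\Omega=\Sigma^{-1}$ and $\theta=(\beta,\Omega,\sigma)$; $\mathbb{P}_\theta,\mathbb{E}_\theta$ are the corresponding probability and expectation. $\|x\|_0$ is the number of nonzero entries of $x$, $\mathrm{supp}(x)$ the set of their indices. Parameter space (known design covariance and noise level): $\Theta(k,\mathrm{I},\sigma_0)=\{(\beta,\mathrm{I},\sigma_0):\|\beta\|_0\le k\}$. Loadings: $\Xi(q,\bar c)=\{\xi\in\mathbb{R}^p:\ \|\xi\|_0=q,\ \xi\ne 0,\ \max_{j\in\mathrm{supp}(\xi)}|\xi_j|\le\bar c\min_{j\in\mathrm{supp}(\xi)}|\xi_j|\}$. Confidence intervals: for a parameter space $\Theta$ and functional $\mathrm{T}$ of $\beta$, $\mathcal{I}_\alpha(\Theta,\mathrm{T})$ is the set of all intervals $\mathrm{CI}=[l(Z),u(Z)]$ with $\inf_{\theta\in\Theta}\mathbb{P}_\theta(l(Z)\le \mathrm{T}(\beta)\le u(Z))\ge 1-\alpha$; the length is $L(\mathrm{CI})=u(Z)-l(Z)$. For $\Theta_1\subseteq\Theta$, $L^*_\alpha(\Theta_1,\Theta,\mathrm{T})=\inf_{\mathrm{CI}\in\mathcal{I}_\alpha(\Theta,\mathrm{T})}\sup_{\theta\in\Theta_1}\mathbb{E}_\theta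 L(\mathrm{CI})$. *)

theory Defs
  imports "HOL-Probability.Probability" "Jordan_Normal_Form.Determinant"
begin

definition supp_vec :: "real vec \<Rightarrow> nat set" where
  "supp_vec x = {j. j < dim_vec x \<and> vec_index x j \<noteq> 0}"

definition l0_norm :: "real vec \<Rightarrow> nat" where
  "l0_norm x = card (supp_vec x)"

text \<open>Intended for vectors of positive dimension (the maximum is over a nonempty set).\<close>

definition linf_norm :: "real vec \<Rightarrow> real" where
  "linf_norm x = Max ((\<lambda>j. \<bar>vec_index x j\<bar>) ` {..<dim_vec x})"

definition loadings :: "nat \<Rightarrow> nat \<Rightarrow> real \<Rightarrow> real vec set" where
  "loadings p q cbar = {\<xi> \<in> carrier_vec p.
     l0_norm \<xi> = q \<and> \<xi> \<noteq> 0\<^sub>v p \<and>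
     Max ((\<lambda>j. \<bar>vec_index \<xi> j\<bar>) ` supp_vec \<xi>)
       \<le> cbar * Min ((\<lambda>j. \<bar>vec_index \<xi> j\<bar>) ` supp_vec \<xi>)}"

text \<open>The Gaussian law \<open>N\<^sub>p(0, \<Sigma>)\<close>, by its density, written in terms of the precision matrix
  \<open>\<Omega> = \<Sigma>\<^sup>-\<^sup>1\<close> (symmetric positive definite of size \<open>p\<close>).  Points of the \<open>p\<close>-dimensional sample
  space are functions on the index set \<open>{..<p}\<close>.\<close>

definition mv_gaussian :: "nat \<Rightarrow> real mat \<Rightarrow> (nat \<Rightarrow> real) measure" where
  "mv_gaussian p \<Omega> = density (\<Pi>\<^sub>M j\<in>{..<p}. lborel)
     (\<lambda>x. ennreal (sqrt (Determinant.det \<Omega> / (2 * pi) ^ p) *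
        exp (- scalar_prod (vec p x) (mult_mat_vec \<Omega> (vec p x)) / 2)))"

text \<open>A parameter is a triple \<open>\<theta> = (\<beta>, \<Omega>, \<sigma>)\<close>.\<close>

type_synonym param = "real vec \<times> real mat \<times> real"

definition param_space :: "nat \<Rightarrow> nat \<Rightarrow> real mat \<Rightarrow> real \<Rightarrow> param set" where
  "param_space p k \<Omega> \<sigma> = {(\<beta>, \<Omega>, \<sigma>) | \<beta>. \<beta> \<in> carrier_vec p \<and> l0_norm \<beta> \<le> k}"

text \<open>A data set is \<open>Z = (Z\<^sub>i)\<close>, \<open>i < n\<close>, with \<open>Z\<^sub>i = (y\<^sub>i, X\<^sub>i)\<close> and \<open>X\<^sub>i\<close> the \<open>i\<close>-th row of the
  design.\<close>

type_synonym data = "nat \<Rightarrow> real \<times> (nat \<Rightarrow> real)"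

definition data_space :: "nat \<Rightarrow> nat \<Rightarrow> data measure" where
  "data_space n p = (\<Pi>\<^sub>M i\<in>{..<n}. borel \<Otimes>\<^sub>M (\<Pi>\<^sub>M j\<in>{..<p}. borel))"

definition data_law :: "nat \<Rightarrow> nat \<Rightarrow> param \<Rightarrow> data measure" where
  "data_law n p \<theta> = (case \<theta> of (\<beta>, \<Omega>, \<sigma>) \<Rightarrow>
     distr
       ((\<Pi>\<^sub>M i\<in>{..<n}. mv_gaussian p \<Omega>) \<Otimes>\<^sub>M
        (\<Pi>\<^sub>M i\<in>{..<n}. density lborel (\<lambda>e. ennreal (normal_density 0 \<sigma> e))))
       (data_space n p)
       (\<lambda>(X, \<epsilon>). \<lambda>i\<in>{..<n}. (scalar_prod (vec p (X i)) \<beta> + \<epsilon> i, X i)))"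

text \<open>The interval \<open>[l(Z), u(Z)]\<close> is represented by the pair \<open>(l, u)\<close>; \<open>T\<close> is a functional of \<open>\<beta>\<close>.\<close>

definition conf_intervals ::
  "nat \<Rightarrow> nat \<Rightarrow> real \<Rightarrow> param set \<Rightarrow> (real vec \<Rightarrow> real) \<Rightarrow> ((data \<Rightarrow> real) \<times> (data \<Rightarrow> real)) set" where
  "conf_intervals n p \<alpha> \<Theta> T = {(l, u).
     l \<in> borel_measurable (data_space n p) \<and>
     u \<in> borel_measurable (data_space n p) \<and>
     (\<forall>z \<in> space (data_space n p). l z \<le> u z) \<and>
     ennreal (1 - \<alpha>) \<le> (INF (\<beta>, \<Omega>, \<sigma>) \<in> \<Theta>.
       emeasure (data_law n p (\<beta>, \<Omega>, \<sigma>))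
         {z \<in> space (data_space n p). l z \<le> T \<beta> \<and> T \<beta> \<le> u z})}"

text \<open>Expected lengths may be infinite, so everything is valued in \<^typ>\<open>ennreal\<close>.\<close>

definition opt_length ::
  "nat \<Rightarrow> nat \<Rightarrow> real \<Rightarrow> param set \<Rightarrow> param set \<Rightarrow> (real vec \<Rightarrow> real) \<Rightarrow> ennreal" where
  "opt_length n p \<alpha> \<Theta>\<^sub>1 \<Theta> T =
     (INF (l, u) \<in> conf_intervals n p \<alpha> \<Theta> T.
        SUP \<theta> \<in> \<Theta>\<^sub>1. \<integral>\<^sup>+ z. ennreal (u z - l z) \<partial>data_law n p \<theta>)"

end

theory Submission
  imports Defs
begin

text \<open>
  An interval that covers \<open>\<xi>\<^sup>T\<beta>\<close> over the large parameter space must be long at some parameter \<open>\<theta>\<close>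
  of the small one if the data under \<open>\<theta>\<close> look like data under parameters with a much larger value of
  the functional. Two families of regression vectors make this precise: one inside the
  \<open>k\<^sub>1\<close>-sparse vectors with functional at most \<open>0\<close>, one inside the \<open>k\<close>-sparse vectors with functional
  at least \<open>\<Delta>\<close>, such that the laws of the data, averaged over each family, nearly coincide. Then some
  member of the first family has expected length at least a constant times \<open>\<Delta>\<close>
  (\<open>expected_length_lower_bound\<close>).

  Both families have the same form. The support consists of \<open>K\<close> coordinates drawn at random from
  \<open>supp \<xi>\<close>, one from each of \<open>K\<close> disjoint blocks, and the coefficients are
  \<open>d\<close> times the signs of the loadings, so that the functional is \<open>d\<close> times the sum of the
  \<open>\<bar>\<xi>\<^sub>j\<bar>\<close> over the support. Each family is compared with the law in which the
  responses are \<open>N(0, s\<^sup>2)\<close> and independent of the design, by computing the chi-square divergence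
  exactly: for one observation and two parameters with squared norm \<open>\<tau>\<^sup>2\<close> and inner product
  \<open>\<rho>\<close> that agree wherever both are nonzero, the second moment of the likelihood ratio is
  \<open>s\<^sup>2 / sqrt ((s\<^sup>2 - \<rho>)\<^sup>2 - D\<^sup>2)\<close> with \<open>D = s\<^sup>2 -
  \<sigma>\<^sup>2 - \<tau>\<^sup>2\<close> (\<open>nn_integral_lik_ratio_pair\<close>). For \<open>n\<close>
  observations the variance mismatch \<open>D\<close> costs a factor \<open>exp (4 n (D / s\<^sup>2)\<^sup>2)\<close>,
  and each coordinate shared by two draws costs \<open>exp (2 n d\<^sup>2 / s\<^sup>2)\<close>. With \<open>d\<close>
  at most a small multiple of \<open>\<sigma> sqrt (ln p / n)\<close> the latter is a small power of \<open>p\<close>,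
  while two draws share only about \<open>K\<^sup>2 / q\<close> coordinates; for \<open>K\<close> at most of order
  \<open>p powr \<gamma>\<close> this is a negative power of \<open>p\<close> exactly because \<open>2\<gamma> <
  \<gamma>\<^sub>q\<close> (\<open>agreement_factor_bound\<close>). So only the mismatch restricts the choice further,
  and the two terms of the maximum are the two ways to control it.

  For \<open>sqrt (k k\<^sub>1) sqrt (ln p / n)\<close> the mismatch is removed: \<open>k\<^sub>1\<close> coefficients of
  order \<open>- sqrt (ln p / n)\<close> are set against \<open>k\<close> positive coefficients of the same total energy, which
  are smaller by the factor \<open>sqrt (k\<^sub>1 / k)\<close>, and \<open>s\<^sup>2\<close> is the common variance of a response. For the
  other term the first family is \<open>\<beta> = 0\<close> and the mismatch \<open>k d\<^sup>2\<close> is kept below order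
  \<open>n powr (-1/2)\<close>, that is, \<open>d\<close> is of order \<open>min (sqrt (ln p / n)) (1 / (sqrt k n powr (1/4)))\<close>.
\<close>

section \<open>Densities and images of product measures\<close>

lemma PiM_density:
  assumes I: "finite I" and M: "product_sigma_finite M"
    and f: "\<And>i. f i \<in> borel_measurable (M i)"
    and Mf: "product_sigma_finite (\<lambda>i. density (M i) (f i))"
  shows "PiM I (\<lambda>i. density (M i) (f i)) = density (PiM I M) (\<lambda>x. \<Prod>i\<in>I. f i (x i))"
proof (rule sym, rule product_sigma_finite.PiM_eqI[OF Mf I])
  interpret product_sigma_finite M by fact
  note f[measurable]
  show "sets (density (PiM I M) (\<lambda>x. \<Prod>i\<in>I. f i (x i))) = sets (PiM I (\<lambda>i. density (M i) (f i)))"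
    by (simp cong: sets_PiM_cong)
  fix A assume A: "\<And>i. i \<in> I \<Longrightarrow> A i \<in> sets (density (M i) (f i))"
  then have A'[measurable]: "\<And>i. i \<in> I \<Longrightarrow> A i \<in> sets (M i)" by simp
  have meas: "(\<lambda>x. \<Prod>i\<in>I. f i (x i)) \<in> borel_measurable (PiM I M)"
    by (intro borel_measurable_prod_ennreal measurable_compose[OF measurable_component_singleton, where g="f _"] f)
  have "emeasure (density (PiM I M) (\<lambda>x. \<Prod>i\<in>I. f i (x i))) (PiE I A)
      = (\<integral>\<^sup>+x. (\<Prod>i\<in>I. f i (x i)) * indicator (PiE I A) x \<partial>PiM I M)"
    by (rule emeasure_density[OF meas]) (intro sets_PiM_I_finite I A')
  also have "\<dots> = (\<integral>\<^sup>+x. (\<Prod>i\<in>I. f i (x i) * indicator (A i) (x i)) \<partial>PiM I M)"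
  proof (rule nn_integral_cong)
    fix x assume "x \<in> space (PiM I M)"
    then have "indicator (PiE I A) x = (\<Prod>i\<in>I. indicator (A i) (x i) :: ennreal)"
      using I by (auto simp: space_PiM PiE_def Pi_def prod.If_cases indicator_def prod_zero_iff)
    then show "(\<Prod>i\<in>I. f i (x i)) * indicator (PiE I A) x
        = (\<Prod>i\<in>I. f i (x i) * indicator (A i) (x i))"
      by (simp add: prod.distrib)
  qed
  also have "\<dots> = (\<Prod>i\<in>I. \<integral>\<^sup>+x. f i x * indicator (A i) x \<partial>M i)"
    by (intro product_nn_integral_prod I) measurable
  also have "\<dots> = (\<Prod>i\<in>I. emeasure (density (M i) (f i)) (A i))"
    by (intro prod.cong refl emeasure_density[symmetric]) auto
  finally show "emeasure (density (PiM I M) (\<lambda>x. \<Prod>i\<in>I. f i (x i))) (PiE I A)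
      = (\<Prod>i\<in>I. emeasure (density (M i) (f i)) (A i))" .
qed

text \<open>Drawing all designs, drawing all errors and then combining them entry by entry is the same as
  drawing independent combined observations. This turns the data law into a product over the
  observations, so that likelihoods and their second moments become products as well.\<close>

lemma distr_pair_PiM:
  assumes I: "finite I" and M: "\<And>i. prob_space (M i)" and N: "\<And>i. prob_space (N i)"
    and f: "\<And>i. f i \<in> M i \<Otimes>\<^sub>M N i \<rightarrow>\<^sub>M K i"
  shows "distr (PiM I M \<Otimes>\<^sub>M PiM I N) (PiM I K) (\<lambda>(x, y). \<lambda>i\<in>I. f i (x i, y i))
       = PiM I (\<lambda>i. distr (M i \<Otimes>\<^sub>M N i) (K i) (f i))"
proof -
  note f[measurable]
  interpret M: product_sigma_finite M
    using M by (simp add: product_sigma_finite_def prob_space_imp_sigma_finite)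
  interpret N: product_sigma_finite N
    using N by (simp add: product_sigma_finite_def prob_space_imp_sigma_finite)
  interpret PM: prob_space "PiM I M" by (intro prob_space_PiM M)
  interpret PN: prob_space "PiM I N" by (intro prob_space_PiM N)
  have P: "prob_space (distr (M i \<Otimes>\<^sub>M N i) (K i) (f i))" for i
  proof -
    interpret pair_prob_space "M i" "N i" using M N
      by (simp add: pair_prob_space_def pair_sigma_finite_def prob_space_imp_sigma_finite)
    show ?thesis by (intro prob_space_distr f)
  qed
  then have psf: "product_sigma_finite (\<lambda>i. distr (M i \<Otimes>\<^sub>M N i) (K i) (f i))"
    by (simp add: product_sigma_finite_def prob_space_imp_sigma_finite)
  have comp: "(\<lambda>z. f i (fst z i, snd z i)) \<in> PiM I M \<Otimes>\<^sub>M PiM I N \<rightarrow>\<^sub>M K i" if "i \<in> I" for i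
    using that by measurable
  have T: "(\<lambda>(x, y). \<lambda>i\<in>I. f i (x i, y i)) \<in> PiM I M \<Otimes>\<^sub>M PiM I N \<rightarrow>\<^sub>M PiM I K"
    unfolding split_beta' by (intro measurable_restrict comp)
  show ?thesis
  proof (rule product_sigma_finite.PiM_eqI[OF psf I])
    show "sets (distr (PiM I M \<Otimes>\<^sub>M PiM I N) (PiM I K) (\<lambda>(x, y). \<lambda>i\<in>I. f i (x i, y i)))
      = sets (PiM I (\<lambda>i. distr (M i \<Otimes>\<^sub>M N i) (K i) (f i)))"
      by (simp cong: sets_PiM_cong)
    fix A assume "\<And>i. i \<in> I \<Longrightarrow> A i \<in> sets (distr (M i \<Otimes>\<^sub>M N i) (K i) (f i))"
    then have A[measurable]: "\<And>i. i \<in> I \<Longrightarrow> A i \<in> sets (K i)" by simp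
    have PA: "PiE I A \<in> sets (PiM I K)" by (intro sets_PiM_I_finite I A)
    have ind: "(\<lambda>z. indicator (A i) (f i z) :: ennreal) \<in> borel_measurable (M i \<Otimes>\<^sub>M N i)" if "i \<in> I" for i
      using that by measurable
    have gi: "indicator (PiE I A) (\<lambda>i\<in>I. g i) = (\<Prod>i\<in>I. indicator (A i) (g i) :: ennreal)" for g
      using I by (auto simp: indicator_def prod_zero_iff intro!: prod.neutral)
    have "emeasure (distr (PiM I M \<Otimes>\<^sub>M PiM I N) (PiM I K) (\<lambda>(x, y). \<lambda>i\<in>I. f i (x i, y i))) (PiE I A)
        = (\<integral>\<^sup>+z. indicator (PiE I A) z
             \<partial>distr (PiM I M \<Otimes>\<^sub>M PiM I N) (PiM I K) (\<lambda>(x, y). \<lambda>i\<in>I. f i (x i, y i)))"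
      using PA by (intro nn_integral_indicator[symmetric]) simp
    also have "\<dots> = (\<integral>\<^sup>+z. (\<Prod>i\<in>I. indicator (A i) (f i (fst z i, snd z i))) \<partial>(PiM I M \<Otimes>\<^sub>M PiM I N))"
      using PA by (subst nn_integral_distr[OF T]) (auto intro!: nn_integral_cong simp: gi[symmetric] split_beta')
    also have "\<dots> = (\<integral>\<^sup>+x. \<integral>\<^sup>+y. (\<Prod>i\<in>I. indicator (A i) (f i (x i, y i))) \<partial>PiM I N \<partial>PiM I M)"
      by (subst PN.nn_integral_fst[symmetric])
         (auto intro!: borel_measurable_prod_ennreal measurable_compose[OF comp])
    also have "\<dots> = (\<integral>\<^sup>+x. (\<Prod>i\<in>I. \<integral>\<^sup>+y. indicator (A i) (f i (x i, y)) \<partial>N i) \<partial>PiM I M)"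
    proof (rule nn_integral_cong)
      fix x assume x: "x \<in> space (PiM I M)"
      show "(\<integral>\<^sup>+y. (\<Prod>i\<in>I. indicator (A i) (f i (x i, y i))) \<partial>PiM I N)
         = (\<Prod>i\<in>I. \<integral>\<^sup>+y. indicator (A i) (f i (x i, y)) \<partial>N i)"
      proof (rule N.product_nn_integral_prod[OF I])
        fix i assume i: "i \<in> I"
        with x have "x i \<in> space (M i)" by (auto simp: space_PiM)
        then show "(\<lambda>y. indicator (A i) (f i (x i, y)) :: ennreal) \<in> borel_measurable (N i)"
          by (rule measurable_Pair2[OF ind[OF i]])
      qed
    qed
    also have "\<dots> = (\<Prod>i\<in>I. \<integral>\<^sup>+x. \<integral>\<^sup>+y. indicator (A i) (f i (x, y)) \<partial>N i \<partial>M i)"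
    proof (rule M.product_nn_integral_prod[OF I])
      fix i assume i: "i \<in> I"
      show "(\<lambda>x. \<integral>\<^sup>+y. indicator (A i) (f i (x, y)) \<partial>N i) \<in> borel_measurable (M i)"
        by (rule sigma_finite_measure.borel_measurable_nn_integral_fst[OF prob_space_imp_sigma_finite[OF N] ind[OF i]])
    qed
    also have "\<dots> = (\<Prod>i\<in>I. emeasure (distr (M i \<Otimes>\<^sub>M N i) (K i) (f i)) (A i))"
    proof (rule prod.cong[OF refl])
      fix i assume i: "i \<in> I"
      have "(\<integral>\<^sup>+x. \<integral>\<^sup>+y. indicator (A i) (f i (x, y)) \<partial>N i \<partial>M i)
          = (\<integral>\<^sup>+z. indicator (A i) (f i z) \<partial>(M i \<Otimes>\<^sub>M N i))"
        by (rule sigma_finite_measure.nn_integral_fst[OF prob_space_imp_sigma_finite[OF N] ind[OF i]])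
      also have "\<dots> = (\<integral>\<^sup>+z. indicator (A i) z \<partial>distr (M i \<Otimes>\<^sub>M N i) (K i) (f i))"
        using A[OF i] by (intro nn_integral_distr[OF f, symmetric]) simp
      also have "\<dots> = emeasure (distr (M i \<Otimes>\<^sub>M N i) (K i) (f i)) (A i)"
        using A[OF i] by (intro nn_integral_indicator) simp
      finally show "(\<integral>\<^sup>+x. \<integral>\<^sup>+y. indicator (A i) (f i (x, y)) \<partial>N i \<partial>M i)
          = emeasure (distr (M i \<Otimes>\<^sub>M N i) (K i) (f i)) (A i)" .
    qed
    finally show "emeasure (distr (PiM I M \<Otimes>\<^sub>M PiM I N) (PiM I K) (\<lambda>(x, y). \<lambda>i\<in>I. f i (x i, y i))) (PiE I A)
      = (\<Prod>i\<in>I. emeasure (distr (M i \<Otimes>\<^sub>M N i) (K i) (f i)) (A i))" .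
  qed
qed

abbreviation gauss :: "real \<Rightarrow> real measure" where
  "gauss \<sigma> \<equiv> density lborel (\<lambda>x. ennreal (normal_density 0 \<sigma> x))"

lemma prob_space_gauss: "0 < \<sigma> \<Longrightarrow> prob_space (gauss \<sigma>)"
  by (rule prob_space_normal_density)

lemma product_sigma_finite_gauss: "0 < \<sigma> \<Longrightarrow> product_sigma_finite (\<lambda>_. gauss \<sigma>)"
  by (simp add: product_sigma_finite_def prob_space_imp_sigma_finite prob_space_gauss)

lemma scalar_prod_vec:
  assumes "\<beta> \<in> carrier_vec p"
  shows "scalar_prod (vec p x) \<beta> = (\<Sum>j<p. x j * vec_index \<beta> j)"
  using assms by (simp add: scalar_prod_def lessThan_atLeast0)

lemma mv_gaussian_one: "mv_gaussian p (1\<^sub>m p) = PiM {..<p} (\<lambda>_. gauss 1)"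
proof -
  have "PiM {..<p} (\<lambda>_. gauss 1)
      = density (PiM {..<p} (\<lambda>_. lborel)) (\<lambda>x. \<Prod>j<p. ennreal (normal_density 0 1 (x j)))"
    by (rule PiM_density)
       (use product_sigma_finite_gauss[of 1] in \<open>auto simp: product_sigma_finite_def sigma_finite_lborel\<close>)
  also have "\<dots> = mv_gaussian p (1\<^sub>m p)"
    unfolding mv_gaussian_def
  proof (rule density_cong)
    show "AE x in PiM {..<p} (\<lambda>_. lborel). (\<Prod>j<p. ennreal (normal_density 0 1 (x j))) =
      ennreal (sqrt (Determinant.det (1\<^sub>m p) / (2 * pi) ^ p) *
        exp (- scalar_prod (vec p x) (mult_mat_vec (1\<^sub>m p) (vec p x)) / 2))"
    proof (rule AE_I2)
      fix x :: "nat \<Rightarrow> real"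
      have "(\<Prod>j<p. normal_density 0 1 (x j)) = (1 / sqrt (2 * pi)) ^ p * (\<Prod>j<p. exp (- (x j)\<^sup>2 / 2))"
        by (simp add: std_normal_density_def prod_dividef power_divide)
      also have "(\<Prod>j<p. exp (- (x j)\<^sup>2 / 2)) = exp (\<Sum>j<p. - (x j)\<^sup>2 / 2)"
        by (simp add: exp_sum)
      also have "(\<Sum>j<p. - (x j)\<^sup>2 / 2) = - scalar_prod (vec p x) (mult_mat_vec (1\<^sub>m p) (vec p x)) / 2"
        by (simp add: scalar_prod_vec sum_negf sum_divide_distrib power2_eq_square)
      also have "(1 / sqrt (2 * pi)) ^ p = sqrt (Determinant.det (1\<^sub>m p :: real mat) / (2 * pi) ^ p)"
        by (simp only: det_one real_sqrt_divide real_sqrt_power power_divide real_sqrt_one power_one)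
      finally show "(\<Prod>j<p. ennreal (normal_density 0 1 (x j))) =
        ennreal (sqrt (Determinant.det (1\<^sub>m p) / (2 * pi) ^ p) *
          exp (- scalar_prod (vec p x) (mult_mat_vec (1\<^sub>m p) (vec p x)) / 2))"
        by (simp add: prod_ennreal)
    qed
  qed (auto simp: scalar_prod_vec)
  finally show ?thesis by simp
qed

section \<open>The law of the data as a product of observations\<close>

definition obs_law :: "nat \<Rightarrow> real vec \<Rightarrow> real \<Rightarrow> (real \<times> (nat \<Rightarrow> real)) measure" where
  "obs_law p \<beta> \<sigma> = distr (mv_gaussian p (1\<^sub>m p) \<Otimes>\<^sub>M gauss \<sigma>) (borel \<Otimes>\<^sub>M PiM {..<p} (\<lambda>_. borel))
     (\<lambda>(x, e). (scalar_prod (vec p x) \<beta> + e, x))"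

text \<open>The reference law is that of a response \<open>N(0, s\<^sup>2)\<close> independent of the design; as the design has the
  same law on both sides, only the conditional densities of the response appear.\<close>

definition lik_ratio :: "nat \<Rightarrow> real vec \<Rightarrow> real \<Rightarrow> real \<Rightarrow> real \<times> (nat \<Rightarrow> real) \<Rightarrow> real" where
  "lik_ratio p \<beta> \<sigma> s = (\<lambda>(y, x). normal_density 0 \<sigma> (y - (\<Sum>j<p. x j * vec_index \<beta> j)) / normal_density 0 s y)"

lemma sets_gauss_PiM [measurable_cong]: "sets (PiM I (\<lambda>_. gauss \<sigma>)) = sets (PiM I (\<lambda>_. borel))"
  by (simp cong: sets_PiM_cong)

lemma lik_ratio_measurable [measurable]:
  "lik_ratio p \<beta> \<sigma> s \<in> borel_measurable (borel \<Otimes>\<^sub>M PiM {..<p} (\<lambda>_. borel))"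
  unfolding lik_ratio_def by measurable

lemma lik_ratio_nonneg [simp]: "0 \<le> lik_ratio p \<beta> \<sigma> s z"
  by (simp add: lik_ratio_def split_beta)

lemma sets_obs_law [simp, measurable_cong]: "sets (obs_law p \<beta> \<sigma>) = sets (borel \<Otimes>\<^sub>M PiM {..<p} (\<lambda>_. borel))"
  by (simp add: obs_law_def)

context
  fixes p :: nat and \<beta> :: "real vec" and \<sigma> :: real
  assumes \<beta>: "\<beta> \<in> carrier_vec p" and \<sigma>: "0 < \<sigma>"
begin

interpretation E: prob_space "gauss \<sigma>" by (rule prob_space_gauss[OF \<sigma>])
interpretation X: prob_space "PiM {..<p} (\<lambda>_. gauss 1)" by (intro prob_space_PiM prob_space_gauss) simp
interpretation pair_prob_space "PiM {..<p} (\<lambda>_. gauss 1)" "gauss \<sigma>" ..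

lemma obs_map_measurable:
  "(\<lambda>(x, e). (scalar_prod (vec p x) \<beta> + e, x))
     \<in> PiM {..<p} (\<lambda>_. gauss 1) \<Otimes>\<^sub>M gauss \<sigma> \<rightarrow>\<^sub>M borel \<Otimes>\<^sub>M PiM {..<p} (\<lambda>_. borel)"
  unfolding scalar_prod_vec[OF \<beta>] by measurable

lemma prob_space_obs_law: "prob_space (obs_law p \<beta> \<sigma>)"
  unfolding obs_law_def mv_gaussian_one by (rule prob_space_distr[OF obs_map_measurable])

lemma data_law_eq_PiM:
  "data_law n p (\<beta>, 1\<^sub>m p, \<sigma>) = PiM {..<n} (\<lambda>_. obs_law p \<beta> \<sigma>)"
proof -
  have "PiM {..<n} (\<lambda>_. obs_law p \<beta> \<sigma>)
     = distr (PiM {..<n} (\<lambda>_. PiM {..<p} (\<lambda>_. gauss 1)) \<Otimes>\<^sub>M PiM {..<n} (\<lambda>_. gauss \<sigma>))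
         (PiM {..<n} (\<lambda>_. borel \<Otimes>\<^sub>M PiM {..<p} (\<lambda>_. borel)))
         (\<lambda>(x, y). \<lambda>i\<in>{..<n}. (\<lambda>(x, e). (scalar_prod (vec p x) \<beta> + e, x)) (x i, y i))"
    unfolding obs_law_def mv_gaussian_one
    by (rule distr_pair_PiM[symmetric]) (auto intro: X.prob_space_axioms E.prob_space_axioms obs_map_measurable)
  then show ?thesis
    by (simp add: data_law_def data_space_def mv_gaussian_one split_beta)
qed

lemma nn_integral_obs_law:
  assumes F[measurable]: "F \<in> borel_measurable (borel \<Otimes>\<^sub>M PiM {..<p} (\<lambda>_. borel))"
  shows "(\<integral>\<^sup>+z. F z \<partial>obs_law p \<beta> \<sigma>)
    = (\<integral>\<^sup>+x. \<integral>\<^sup>+y. F (y, x) * normal_density 0 \<sigma> (y - (\<Sum>j<p. x j * vec_index \<beta> j)) \<partial>lborel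
         \<partial>PiM {..<p} (\<lambda>_. gauss 1))"
proof -
  have "(\<integral>\<^sup>+z. F z \<partial>obs_law p \<beta> \<sigma>)
      = (\<integral>\<^sup>+w. F (case w of (x, e) \<Rightarrow> (scalar_prod (vec p x) \<beta> + e, x))
           \<partial>(PiM {..<p} (\<lambda>_. gauss 1) \<Otimes>\<^sub>M gauss \<sigma>))"
    unfolding obs_law_def mv_gaussian_one by (rule nn_integral_distr[OF obs_map_measurable]) simp
  also have "\<dots> = (\<integral>\<^sup>+x. \<integral>\<^sup>+e. F (scalar_prod (vec p x) \<beta> + e, x) \<partial>gauss \<sigma> \<partial>PiM {..<p} (\<lambda>_. gauss 1))"
    by (subst E.nn_integral_fst[symmetric])
       (use measurable_compose[OF obs_map_measurable F] in \<open>auto simp: split_beta\<close>)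
  also have "\<dots> = (\<integral>\<^sup>+x. \<integral>\<^sup>+y. F (y, x) * normal_density 0 \<sigma> (y - (\<Sum>j<p. x j * vec_index \<beta> j)) \<partial>lborel
         \<partial>PiM {..<p} (\<lambda>_. gauss 1))"
  proof (rule nn_integral_cong)
    fix x assume "x \<in> space (PiM {..<p} (\<lambda>_. gauss 1))"
    then have [measurable]: "x \<in> space (PiM {..<p} (\<lambda>_. borel))" by (simp add: space_PiM)
    let ?m = "\<Sum>j<p. x j * vec_index \<beta> j"
    have [measurable]: "(\<lambda>y. F (y, x)) \<in> borel_measurable borel"
      by measurable
    have "(\<integral>\<^sup>+e. F (scalar_prod (vec p x) \<beta> + e, x) \<partial>gauss \<sigma>)
       = (\<integral>\<^sup>+e. F (?m + e, x) * normal_density 0 \<sigma> e \<partial>lborel)"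
      by (subst nn_integral_density) (auto simp: scalar_prod_vec[OF \<beta>] mult.commute)
    also have "\<dots> = (\<integral>\<^sup>+y. F (y, x) * normal_density 0 \<sigma> (y - ?m) \<partial>lborel)"
      by (subst nn_integral_real_affine[of "\<lambda>y. F (y, x) * normal_density 0 \<sigma> (y - ?m)" 1 ?m]) auto
    finally show "(\<integral>\<^sup>+e. F (scalar_prod (vec p x) \<beta> + e, x) \<partial>gauss \<sigma>)
       = (\<integral>\<^sup>+y. F (y, x) * normal_density 0 \<sigma> (y - ?m) \<partial>lborel)" .
  qed
  finally show ?thesis .
qed

end

lemma obs_law_eq_density:
  assumes \<beta>: "\<beta> \<in> carrier_vec p" and \<sigma>: "0 < \<sigma>" and s: "0 < s"
  shows "obs_law p \<beta> \<sigma> = density (obs_law p (0\<^sub>v p) s) (\<lambda>z. ennreal (lik_ratio p \<beta> \<sigma> s z))"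
proof (rule measure_eqI)
  fix A assume "A \<in> sets (obs_law p \<beta> \<sigma>)"
  then have A[measurable]: "A \<in> sets (borel \<Otimes>\<^sub>M PiM {..<p} (\<lambda>_. borel))" by simp
  have "emeasure (density (obs_law p (0\<^sub>v p) s) (\<lambda>z. ennreal (lik_ratio p \<beta> \<sigma> s z))) A
     = (\<integral>\<^sup>+z. ennreal (lik_ratio p \<beta> \<sigma> s z) * indicator A z \<partial>obs_law p (0\<^sub>v p) s)"
    by (rule emeasure_density) auto
  also have "\<dots> = (\<integral>\<^sup>+x. \<integral>\<^sup>+y. ennreal (lik_ratio p \<beta> \<sigma> s (y, x)) * indicator A (y, x) * normal_density 0 s y \<partial>lborel
         \<partial>PiM {..<p} (\<lambda>_. gauss 1))"
    by (subst nn_integral_obs_law) (auto simp: s)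
  also have "\<dots> = (\<integral>\<^sup>+x. \<integral>\<^sup>+y. indicator A (y, x) * ennreal (normal_density 0 \<sigma> (y - (\<Sum>j<p. x j * vec_index \<beta> j))) \<partial>lborel
         \<partial>PiM {..<p} (\<lambda>_. gauss 1))"
  proof (rule nn_integral_cong, rule nn_integral_cong)
    fix x :: "nat \<Rightarrow> real" and y :: real
    have "ennreal (lik_ratio p \<beta> \<sigma> s (y, x)) * normal_density 0 s y
       = ennreal (normal_density 0 \<sigma> (y - (\<Sum>j<p. x j * vec_index \<beta> j)))"
      using normal_density_pos[OF s, of 0 y] by (simp add: lik_ratio_def flip: ennreal_mult)
    then show "ennreal (lik_ratio p \<beta> \<sigma> s (y, x)) * indicator A (y, x) * normal_density 0 s y
       = indicator A (y, x) * ennreal (normal_density 0 \<sigma> (y - (\<Sum>j<p. x j * vec_index \<beta> j)))"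
      by (metis mult.assoc mult.commute)
  qed
  also have "\<dots> = (\<integral>\<^sup>+z. indicator A z \<partial>obs_law p \<beta> \<sigma>)"
    by (rule nn_integral_obs_law[OF \<beta> \<sigma>, symmetric]) auto
  also have "\<dots> = emeasure (obs_law p \<beta> \<sigma>) A"
    by simp
  finally show "emeasure (obs_law p \<beta> \<sigma>) A
    = emeasure (density (obs_law p (0\<^sub>v p) s) (\<lambda>z. ennreal (lik_ratio p \<beta> \<sigma> s z))) A" ..
qed simp

lemma data_law_eq_density:
  assumes \<beta>: "\<beta> \<in> carrier_vec p" and \<sigma>: "0 < \<sigma>" and s: "0 < s"
  shows "data_law n p (\<beta>, 1\<^sub>m p, \<sigma>) = density (data_law n p (0\<^sub>v p, 1\<^sub>m p, s))
           (\<lambda>z. ennreal (\<Prod>i<n. lik_ratio p \<beta> \<sigma> s (z i)))"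
proof -
  have 0: "0\<^sub>v p \<in> carrier_vec p" by simp
  have "data_law n p (\<beta>, 1\<^sub>m p, \<sigma>)
     = PiM {..<n} (\<lambda>_. density (obs_law p (0\<^sub>v p) s) (\<lambda>z. ennreal (lik_ratio p \<beta> \<sigma> s z)))"
    by (simp add: data_law_eq_PiM[OF \<beta> \<sigma>] obs_law_eq_density[OF assms])
  also have "\<dots> = density (PiM {..<n} (\<lambda>_. obs_law p (0\<^sub>v p) s)) (\<lambda>z. \<Prod>i<n. ennreal (lik_ratio p \<beta> \<sigma> s (z i)))"
    by (rule PiM_density)
       (auto simp: product_sigma_finite_def prob_space_imp_sigma_finite prob_space_obs_law[OF 0 s]
          prob_space_obs_law[OF \<beta> \<sigma>] simp flip: obs_law_eq_density[OF assms])
  finally show ?thesis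
    by (simp add: data_law_eq_PiM[OF 0 s] prod_ennreal)
qed

text \<open>The chi-square divergence tensorizes: for independent observations its second moment is the
  \<open>n\<close>-th power of that of a single one.\<close>

lemma nn_integral_lik_ratio_product:
  assumes s: "0 < s"
  shows "(\<integral>\<^sup>+z. ennreal (\<Prod>i<n. lik_ratio p \<beta> \<sigma> s (z i)) * ennreal (\<Prod>i<n. lik_ratio p \<beta>' \<sigma> s (z i))
            \<partial>data_law n p (0\<^sub>v p, 1\<^sub>m p, s))
    = (\<integral>\<^sup>+z. ennreal (lik_ratio p \<beta> \<sigma> s z * lik_ratio p \<beta>' \<sigma> s z) \<partial>obs_law p (0\<^sub>v p) s) ^ n"
proof -
  have 0: "0\<^sub>v p \<in> carrier_vec p" by simp
  interpret product_sigma_finite "\<lambda>_. obs_law p (0\<^sub>v p) s"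
    by (simp add: product_sigma_finite_def prob_space_imp_sigma_finite prob_space_obs_law[OF 0 s])
  have "(\<integral>\<^sup>+z. ennreal (\<Prod>i<n. lik_ratio p \<beta> \<sigma> s (z i)) * ennreal (\<Prod>i<n. lik_ratio p \<beta>' \<sigma> s (z i))
            \<partial>data_law n p (0\<^sub>v p, 1\<^sub>m p, s))
     = (\<integral>\<^sup>+z. (\<Prod>i<n. ennreal (lik_ratio p \<beta> \<sigma> s (z i) * lik_ratio p \<beta>' \<sigma> s (z i)))
            \<partial>PiM {..<n} (\<lambda>_. obs_law p (0\<^sub>v p) s))"
    by (simp add: data_law_eq_PiM[OF 0 s] ennreal_mult[symmetric] prod_nonneg prod.distrib[symmetric] prod_ennreal)
  also have "\<dots> = (\<Prod>i<n. \<integral>\<^sup>+z. ennreal (lik_ratio p \<beta> \<sigma> s z * lik_ratio p \<beta>' \<sigma> s z) \<partial>obs_law p (0\<^sub>v p) s)"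
    by (rule product_nn_integral_prod) auto
  finally show ?thesis by simp
qed

section \<open>The second moment of the likelihood ratio\<close>

lemma gauss_smoothing:
  assumes \<sigma>: "0 < \<sigma>"
  shows "(\<integral>\<^sup>+x. normal_density 0 \<sigma> (z - x * c) \<partial>gauss 1) = normal_density 0 (sqrt (\<sigma>\<^sup>2 + c\<^sup>2)) z"
proof (cases "c = 0")
  case True
  interpret prob_space "gauss 1" by (rule prob_space_gauss) simp
  from True show ?thesis using \<sigma> emeasure_space_1 by simp
next
  case False
  have scale: "\<bar>c\<bar> * normal_density 0 \<bar>c\<bar> (c * x) = normal_density 0 1 x" for x
    using False by (simp add: normal_density_def real_sqrt_mult power_mult_distrib)
  have "(\<integral>\<^sup>+x. normal_density 0 \<sigma> (z - x * c) \<partial>gauss 1)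
      = (\<integral>\<^sup>+x. ennreal \<bar>c\<bar> * ennreal (normal_density 0 \<sigma> (z - (0 + c * x)) * normal_density 0 \<bar>c\<bar> (0 + c * x)) \<partial>lborel)"
    by (subst nn_integral_density)
       (auto intro!: nn_integral_cong simp: mult_ac ennreal_mult[symmetric] simp flip: scale)
  also have "\<dots> = (\<integral>\<^sup>+y. ennreal (normal_density 0 \<sigma> (z - y) * normal_density 0 \<bar>c\<bar> y) \<partial>lborel)"
    using False by (subst nn_integral_real_affine[of _ c 0]) (auto simp: nn_integral_cmult)
  also have "\<dots> = normal_density 0 (sqrt (\<sigma>\<^sup>2 + c\<^sup>2)) z"
    using fun_cong[OF conv_normal_density_zero_mean[of \<sigma> "\<bar>c\<bar>"], of z] \<sigma> False by simp
  finally show ?thesis .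
qed

text \<open>Two linear forms in disjoint groups of coordinates are independent, so both densities are
  smoothed separately, each coordinate adding its squared coefficient to one of the two variances.\<close>

lemma gauss_smoothing_PiM_disjoint:
  assumes "finite I" and "0 < \<sigma>" and "0 < \<sigma>'" and "\<And>j. j \<in> I \<Longrightarrow> b j = 0 \<or> b' j = 0"
  shows "(\<integral>\<^sup>+x. ennreal (normal_density 0 \<sigma> (z - (\<Sum>j\<in>I. x j * b j)) * normal_density 0 \<sigma>' (z' - (\<Sum>j\<in>I. x j * b' j)))
            \<partial>PiM I (\<lambda>_. gauss 1))
    = ennreal (normal_density 0 (sqrt (\<sigma>\<^sup>2 + (\<Sum>j\<in>I. (b j)\<^sup>2))) z
        * normal_density 0 (sqrt (\<sigma>'\<^sup>2 + (\<Sum>j\<in>I. (b' j)\<^sup>2))) z')"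
  using assms
proof (induction I arbitrary: \<sigma> \<sigma>' rule: finite_induct)
  case empty
  then show ?case by (simp add: space_PiM nn_integral_count_space_finite PiM_empty)
next
  case (insert i I)
  interpret product_sigma_finite "\<lambda>_::'a. gauss 1" by (rule product_sigma_finite_gauss) simp
  let ?s = "sqrt (\<sigma>\<^sup>2 + (b i)\<^sup>2)" and ?s' = "sqrt (\<sigma>'\<^sup>2 + (b' i)\<^sup>2)"
  have pos: "0 < ?s" "0 < ?s'" using insert.prems by (auto intro: add_pos_nonneg)
  have one: "(\<integral>\<^sup>+y. ennreal (normal_density 0 \<sigma> (w - y * b i) * normal_density 0 \<sigma>' (w' - y * b' i)) \<partial>gauss 1)
      = ennreal (normal_density 0 ?s w * normal_density 0 ?s' w')" for w w'
  proof (cases "b i = 0")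
    case True
    then show ?thesis using insert.prems gauss_smoothing[of \<sigma>' w' "b' i"]
      by (simp add: ennreal_mult nn_integral_cmult)
  next
    case False
    then have "b' i = 0" using insert.prems(3)[of i] by auto
    then show ?thesis using insert.prems gauss_smoothing[of \<sigma> w "b i"]
      by (simp add: ennreal_mult nn_integral_multc)
  qed
  have sm: "(\<Sum>j\<in>insert i I. (x(i := y)) j * c j) = (\<Sum>j\<in>I. x j * c j) + y * c i" for x :: "'a \<Rightarrow> real" and y c
  proof -
    have "(\<Sum>j\<in>I. (x(i := y)) j * c j) = (\<Sum>j\<in>I. x j * c j)"
      using insert.hyps by (intro sum.cong) auto
    then show ?thesis using insert.hyps by simp
  qed
  have "(\<integral>\<^sup>+x. ennreal (normal_density 0 \<sigma> (z - (\<Sum>j\<in>insert i I. x j * b j))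
            * normal_density 0 \<sigma>' (z' - (\<Sum>j\<in>insert i I. x j * b' j))) \<partial>PiM (insert i I) (\<lambda>_. gauss 1))
      = (\<integral>\<^sup>+x. \<integral>\<^sup>+y. ennreal (normal_density 0 \<sigma> ((z - (\<Sum>j\<in>I. x j * b j)) - y * b i)
            * normal_density 0 \<sigma>' ((z' - (\<Sum>j\<in>I. x j * b' j)) - y * b' i)) \<partial>gauss 1 \<partial>PiM I (\<lambda>_. gauss 1))"
    by (subst product_nn_integral_insert[OF insert.hyps], measurable)
       (simp only: sm diff_diff_eq)
  also have "\<dots> = (\<integral>\<^sup>+x. ennreal (normal_density 0 ?s (z - (\<Sum>j\<in>I. x j * b j))
            * normal_density 0 ?s' (z' - (\<Sum>j\<in>I. x j * b' j))) \<partial>PiM I (\<lambda>_. gauss 1))"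
    by (simp only: one)
  also have "\<dots> = ennreal (normal_density 0 (sqrt (?s\<^sup>2 + (\<Sum>j\<in>I. (b j)\<^sup>2))) z
        * normal_density 0 (sqrt (?s'\<^sup>2 + (\<Sum>j\<in>I. (b' j)\<^sup>2))) z')"
    by (rule insert.IH[OF pos]) (use insert.prems in auto)
  finally show ?case using insert.hyps by (simp add: add.assoc)
qed

lemma gauss_smoothing_PiM:
  assumes "finite I" and "0 < \<sigma>"
  shows "(\<integral>\<^sup>+x. ennreal (normal_density 0 \<sigma> (z - (\<Sum>j\<in>I. x j * b j))) \<partial>PiM I (\<lambda>_. gauss 1))
    = ennreal (normal_density 0 (sqrt (\<sigma>\<^sup>2 + (\<Sum>j\<in>I. (b j)\<^sup>2))) z)"
proof -
  \<comment> \<open>A second density that ignores the coordinates reduces this to the previous lemma.\<close>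
  let ?c = "normal_density 0 1 0"
  have c: "0 < ?c" by (rule normal_density_pos) simp
  have "(\<integral>\<^sup>+x. ennreal (normal_density 0 \<sigma> (z - (\<Sum>j\<in>I. x j * b j))) \<partial>PiM I (\<lambda>_. gauss 1)) * ennreal ?c
     = (\<integral>\<^sup>+x. ennreal (normal_density 0 \<sigma> (z - (\<Sum>j\<in>I. x j * b j)) * normal_density 0 1 (0 - (\<Sum>j\<in>I. x j * 0))) \<partial>PiM I (\<lambda>_. gauss 1))"
    by (subst nn_integral_multc[symmetric]) (auto simp: ennreal_mult)
  also have "\<dots> = ennreal (normal_density 0 (sqrt (\<sigma>\<^sup>2 + (\<Sum>j\<in>I. (b j)\<^sup>2))) z) * ennreal ?c"
    by (subst gauss_smoothing_PiM_disjoint[OF assms(1,2), of 1 b "\<lambda>_. 0"]) (auto simp: ennreal_mult)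
  finally show ?thesis
    using c by (simp add: mult.commute[of _ "ennreal ?c"] ennreal_mult_cancel_left)
qed

lemma normal_density_square:
  assumes "0 < t"
  shows "normal_density 0 t w * normal_density 0 t w = 1 / (2 * sqrt pi * t) * normal_density 0 (t / sqrt 2) w"
proof -
  have "exp (- w\<^sup>2 / (2 * t\<^sup>2)) * exp (- w\<^sup>2 / (2 * t\<^sup>2)) = exp (- w\<^sup>2 / t\<^sup>2)"
    by (simp flip: exp_add)
  then show ?thesis using assms
    by (simp add: normal_density_def real_sqrt_mult power_divide field_simps)
qed

lemma nn_integral_normal_density_ratio:
  assumes r: "0 < r" and rs: "r < s"
  shows "(\<integral>\<^sup>+y. ennreal (normal_density 0 r y / normal_density 0 s y) \<partial>lborel) = ennreal (s\<^sup>2 * sqrt (2 * pi) / sqrt (s\<^sup>2 - r\<^sup>2))"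
proof -
  from r rs have s: "0 < s" by simp
  have pos: "0 < s\<^sup>2 - r\<^sup>2" using r rs by (simp add: power_strict_mono)
  define v where "v = r * s / sqrt (s\<^sup>2 - r\<^sup>2)"
  have v: "0 < v" unfolding v_def using r s pos by simp
  have v2: "1 / v\<^sup>2 = 1 / r\<^sup>2 - 1 / s\<^sup>2"
    unfolding v_def power_divide power_mult_distrib real_sqrt_pow2[OF less_imp_le[OF pos]]
    using r s by (simp add: field_simps)
  have "normal_density 0 r y / normal_density 0 s y
      = s\<^sup>2 * sqrt (2 * pi) / sqrt (s\<^sup>2 - r\<^sup>2) * normal_density 0 v y" for y
  proof -
    have "exp (- y\<^sup>2 / (2 * r\<^sup>2)) / exp (- y\<^sup>2 / (2 * s\<^sup>2)) = exp (- (y\<^sup>2 / 2) * (1 / r\<^sup>2 - 1 / s\<^sup>2))"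
      by (simp flip: exp_diff add: algebra_simps)
    also have "\<dots> = exp (- y\<^sup>2 / (2 * v\<^sup>2))"
      by (simp flip: v2)
    finally have e: "exp (- y\<^sup>2 / (2 * r\<^sup>2)) / exp (- y\<^sup>2 / (2 * s\<^sup>2)) = exp (- y\<^sup>2 / (2 * v\<^sup>2))" .
    have "normal_density 0 r y / normal_density 0 s y
       = s / r * (exp (- y\<^sup>2 / (2 * r\<^sup>2)) / exp (- y\<^sup>2 / (2 * s\<^sup>2)))"
      using r s by (simp add: normal_density_def real_sqrt_mult field_simps)
    also have "\<dots> = s / r * (sqrt (2 * pi) * v) * normal_density 0 v y"
      unfolding e using v by (simp add: normal_density_def real_sqrt_mult)
    also have "s / r * (sqrt (2 * pi) * v) = s\<^sup>2 * sqrt (2 * pi) / sqrt (s\<^sup>2 - r\<^sup>2)"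
      using r by (simp add: v_def power2_eq_square)
    finally show ?thesis .
  qed
  then have "(\<integral>\<^sup>+y. ennreal (normal_density 0 r y / normal_density 0 s y) \<partial>lborel)
     = ennreal (s\<^sup>2 * sqrt (2 * pi) / sqrt (s\<^sup>2 - r\<^sup>2)) * (\<integral>\<^sup>+y. ennreal (normal_density 0 v y) \<partial>lborel)"
    using pos by (simp add: ennreal_mult[symmetric] nn_integral_cmult[symmetric])
  also have "(\<integral>\<^sup>+y. ennreal (normal_density 0 v y) \<partial>lborel) = 1"
    using v by (subst nn_integral_eq_integral) auto
  finally show ?thesis by simp
qed

text \<open>One plus the chi-square divergence (in its mixed form, for two parameters) of a single
  observation from the reference law. As \<open>b\<close> and \<open>b'\<close> agree on the set \<open>A\<close> of common coordinates and have
  disjoint supports off it, integrating out the coordinates off \<open>A\<close> leaves the same density of variance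
  \<open>t\<^sup>2 = \<sigma>\<^sup>2 + \<tau>2 - \<rho>\<close> twice; its square is again a Gaussian density, of variance \<open>t\<^sup>2 / 2\<close>, which the
  common coordinates smooth to variance \<open>r\<^sup>2 = t\<^sup>2 / 2 + \<rho>\<close>. What remains is a one-dimensional
  integral, finite because \<open>r < s\<close>.\<close>

lemma nn_integral_lik_ratio_pair:
  assumes \<sigma>: "0 < \<sigma>" and s: "0 < s"
    and compat: "\<And>j. j < p \<Longrightarrow> vec_index b j = vec_index b' j \<or> vec_index b j = 0 \<or> vec_index b' j = 0"
    and \<tau>: "(\<Sum>j<p. (vec_index b j)\<^sup>2) = \<tau>2" "(\<Sum>j<p. (vec_index b' j)\<^sup>2) = \<tau>2"
    and \<rho>: "(\<Sum>j<p. vec_index b j * vec_index b' j) = \<rho>"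
    and pos: "\<bar>s\<^sup>2 - \<sigma>\<^sup>2 - \<tau>2\<bar> < s\<^sup>2 - \<rho>"
  shows "(\<integral>\<^sup>+z. ennreal (lik_ratio p b \<sigma> s z * lik_ratio p b' \<sigma> s z) \<partial>obs_law p (0\<^sub>v p) s)
    = ennreal (s\<^sup>2 / sqrt ((s\<^sup>2 - \<rho>)\<^sup>2 - (s\<^sup>2 - \<sigma>\<^sup>2 - \<tau>2)\<^sup>2))"
proof -
  interpret psf: product_sigma_finite "\<lambda>_::nat. gauss 1" by (rule product_sigma_finite_gauss) simp
  interpret X: prob_space "PiM {..<p} (\<lambda>_. gauss 1)" by (intro prob_space_PiM prob_space_gauss) simp
  interpret XY: pair_sigma_finite "PiM {..<p} (\<lambda>_. gauss 1)" lborel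
    by (simp add: pair_sigma_finite_def X.sigma_finite_measure_axioms sigma_finite_lborel)
  define A where "A = {j. j < p \<and> vec_index b j = vec_index b' j}"
  define B where "B = {..<p} - A"
  have AB: "A \<inter> B = {}" "finite A" "finite B" "A \<union> B = {..<p}" by (auto simp: A_def B_def)
  have sumAB: "(\<Sum>j<p. g j) = (\<Sum>j\<in>A. g j) + (\<Sum>j\<in>B. g j)" for g :: "nat \<Rightarrow> real"
    using AB by (simp flip: AB(4) add: sum.union_disjoint)
  have \<rho>A: "\<rho> = (\<Sum>j\<in>A. (vec_index b j)\<^sup>2)"
  proof -
    have "(\<Sum>j\<in>B. vec_index b j * vec_index b' j) = 0"
      using compat by (intro sum.neutral) (auto simp: A_def B_def)
    moreover have "(\<Sum>j\<in>A. vec_index b j * vec_index b' j) = (\<Sum>j\<in>A. (vec_index b j)\<^sup>2)"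
      by (intro sum.cong) (auto simp: A_def power2_eq_square)
    ultimately show ?thesis using sumAB \<rho> by simp
  qed
  have A': "(\<Sum>j\<in>A. (vec_index b' j)\<^sup>2) = \<rho>"
    unfolding \<rho>A by (intro sum.cong) (auto simp: A_def)
  have B1: "(\<Sum>j\<in>B. (vec_index b j)\<^sup>2) = \<tau>2 - \<rho>" and B2: "(\<Sum>j\<in>B. (vec_index b' j)\<^sup>2) = \<tau>2 - \<rho>"
    using \<tau> sumAB[of "\<lambda>j. (vec_index b j)\<^sup>2"] sumAB[of "\<lambda>j. (vec_index b' j)\<^sup>2"] \<rho>A A' by auto
  have \<tau>\<rho>: "\<rho> \<le> \<tau>2" using sum_nonneg[of B "\<lambda>j. (vec_index b j)\<^sup>2"] B1 by simp
  have \<rho>0: "0 \<le> \<rho>" unfolding \<rho>A by (simp add: sum_nonneg)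
  define t where "t = sqrt (\<sigma>\<^sup>2 + (\<tau>2 - \<rho>))"
  have t2: "t\<^sup>2 = \<sigma>\<^sup>2 + (\<tau>2 - \<rho>)" unfolding t_def using \<tau>\<rho> by simp
  have t: "0 < t" unfolding t_def using \<sigma> \<tau>\<rho> by (simp add: add_pos_nonneg)
  define r where "r = sqrt ((t / sqrt 2)\<^sup>2 + \<rho>)"
  have r2: "r\<^sup>2 = t\<^sup>2 / 2 + \<rho>" unfolding r_def using \<rho>0 by (simp add: power_divide)
  have r: "0 < r" unfolding r_def using t \<rho>0 by (simp add: add_pos_nonneg)
  have rs: "r < s"
  proof (rule power_less_imp_less_base)
    show "r\<^sup>2 < s\<^sup>2" using pos unfolding r2 t2 abs_less_iff by (simp add: field_simps)
  qed (use s in simp)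
  let ?L = "\<lambda>b x. \<Sum>j<p. x j * vec_index b j"
  have K: "(\<integral>\<^sup>+x. ennreal (normal_density 0 \<sigma> (y - ?L b x) * normal_density 0 \<sigma> (y - ?L b' x)) \<partial>PiM {..<p} (\<lambda>_. gauss 1))
     = ennreal (1 / (2 * sqrt pi * t) * normal_density 0 r y)" for y
  proof -
    have mA: "(\<Sum>j\<in>A. merge A B (x, w) j * c j) = (\<Sum>j\<in>A. x j * c j)" for x w :: "nat \<Rightarrow> real" and c
      by (intro sum.cong) (auto simp: merge_def)
    have mB: "(\<Sum>j\<in>B. merge A B (x, w) j * c j) = (\<Sum>j\<in>B. w j * c j)" for x w :: "nat \<Rightarrow> real" and c
      using AB(1) by (intro sum.cong) (auto simp: merge_def)
    have AA: "(\<Sum>j\<in>A. x j * vec_index b' j) = (\<Sum>j\<in>A. x j * vec_index b j)" for x :: "nat \<Rightarrow> real"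
      by (intro sum.cong) (auto simp: A_def)
    have "(\<integral>\<^sup>+x. ennreal (normal_density 0 \<sigma> (y - ?L b x) * normal_density 0 \<sigma> (y - ?L b' x)) \<partial>PiM {..<p} (\<lambda>_. gauss 1))
       = (\<integral>\<^sup>+x. \<integral>\<^sup>+w. ennreal (normal_density 0 \<sigma> ((y - (\<Sum>j\<in>A. x j * vec_index b j)) - (\<Sum>j\<in>B. w j * vec_index b j))
             * normal_density 0 \<sigma> ((y - (\<Sum>j\<in>A. x j * vec_index b j)) - (\<Sum>j\<in>B. w j * vec_index b' j)))
             \<partial>PiM B (\<lambda>_. gauss 1) \<partial>PiM A (\<lambda>_. gauss 1))"
      unfolding AB(4)[symmetric]
      by (subst psf.product_nn_integral_fold[OF AB(1-3)], measurable)
         (simp add: AB(4) sumAB mA mB AA diff_diff_eq)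
    also have "\<dots> = (\<integral>\<^sup>+x. ennreal (1 / (2 * sqrt pi * t) *
          normal_density 0 (t / sqrt 2) (y - (\<Sum>j\<in>A. x j * vec_index b j))) \<partial>PiM A (\<lambda>_. gauss 1))"
    proof (rule nn_integral_cong)
      fix x :: "nat \<Rightarrow> real"
      let ?w = "y - (\<Sum>j\<in>A. x j * vec_index b j)"
      have "(\<integral>\<^sup>+w. ennreal (normal_density 0 \<sigma> (?w - (\<Sum>j\<in>B. w j * vec_index b j))
             * normal_density 0 \<sigma> (?w - (\<Sum>j\<in>B. w j * vec_index b' j))) \<partial>PiM B (\<lambda>_. gauss 1))
         = ennreal (normal_density 0 t ?w * normal_density 0 t ?w)"
        using gauss_smoothing_PiM_disjoint[OF AB(3) \<sigma> \<sigma>, of "vec_index b" "vec_index b'" ?w ?w] compat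
        by (auto simp: A_def B_def t_def B1[unfolded A_def B_def] B2[unfolded A_def B_def])
      then show "(\<integral>\<^sup>+w. ennreal (normal_density 0 \<sigma> (?w - (\<Sum>j\<in>B. w j * vec_index b j))
             * normal_density 0 \<sigma> (?w - (\<Sum>j\<in>B. w j * vec_index b' j))) \<partial>PiM B (\<lambda>_. gauss 1))
         = ennreal (1 / (2 * sqrt pi * t) * normal_density 0 (t / sqrt 2) ?w)"
        by (simp only: normal_density_square[OF t])
    qed
    also have "\<dots> = ennreal (1 / (2 * sqrt pi * t)) *
        (\<integral>\<^sup>+x. ennreal (normal_density 0 (t / sqrt 2) (y - (\<Sum>j\<in>A. x j * vec_index b j))) \<partial>PiM A (\<lambda>_. gauss 1))"
      using t by (subst nn_integral_cmult[symmetric]) (auto intro!: nn_integral_cong simp: ennreal_mult simp del: times_divide_eq_left)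
    also have "\<dots> = ennreal (1 / (2 * sqrt pi * t)) * ennreal (normal_density 0 r y)"
      using t by (subst gauss_smoothing_PiM[OF AB(2)]) (auto simp: r_def simp flip: \<rho>A)
    finally show ?thesis using t by (simp add: ennreal_mult[symmetric])
  qed
  have ratio: "lik_ratio p b \<sigma> s (y, x) * lik_ratio p b' \<sigma> s (y, x) * normal_density 0 s y
      = normal_density 0 \<sigma> (y - ?L b x) * normal_density 0 \<sigma> (y - ?L b' x) * (1 / normal_density 0 s y)" for x y
    using normal_density_pos[OF s, of 0 y] by (simp add: lik_ratio_def)
  have "(\<integral>\<^sup>+z. ennreal (lik_ratio p b \<sigma> s z * lik_ratio p b' \<sigma> s z) \<partial>obs_law p (0\<^sub>v p) s)
     = (\<integral>\<^sup>+x. \<integral>\<^sup>+y. ennreal (normal_density 0 \<sigma> (y - ?L b x) * normal_density 0 \<sigma> (y - ?L b' x)) * ennreal (1 / normal_density 0 s y)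
          \<partial>lborel \<partial>PiM {..<p} (\<lambda>_. gauss 1))"
    by (subst nn_integral_obs_law) (auto simp: s ratio simp flip: ennreal_mult intro!: nn_integral_cong)
  also have "\<dots> = (\<integral>\<^sup>+y. \<integral>\<^sup>+x. ennreal (normal_density 0 \<sigma> (y - ?L b x) * normal_density 0 \<sigma> (y - ?L b' x)) * ennreal (1 / normal_density 0 s y)
          \<partial>PiM {..<p} (\<lambda>_. gauss 1) \<partial>lborel)"
    by (rule XY.Fubini'[symmetric]) measurable
  also have "\<dots> = (\<integral>\<^sup>+y. ennreal (1 / (2 * sqrt pi * t) * normal_density 0 r y) * ennreal (1 / normal_density 0 s y) \<partial>lborel)"
    by (intro nn_integral_cong) (subst nn_integral_multc, measurable, simp only: K)
  also have "\<dots> = (\<integral>\<^sup>+y. ennreal (1 / (2 * sqrt pi * t)) * ennreal (normal_density 0 r y / normal_density 0 s y) \<partial>lborel)"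
    using t by (intro nn_integral_cong) (simp flip: ennreal_mult)
  also have "\<dots> = ennreal (1 / (2 * sqrt pi * t)) * ennreal (s\<^sup>2 * sqrt (2 * pi) / sqrt (s\<^sup>2 - r\<^sup>2))"
    by (subst nn_integral_cmult) (auto simp: nn_integral_normal_density_ratio[OF r rs])
  also have "\<dots> = ennreal (1 / (2 * sqrt pi * t) * (s\<^sup>2 * sqrt (2 * pi) / sqrt (s\<^sup>2 - r\<^sup>2)))"
    using t by (intro ennreal_mult[symmetric]) (use r rs in \<open>auto intro!: divide_nonneg_nonneg\<close>)
  also have "1 / (2 * sqrt pi * t) * (s\<^sup>2 * sqrt (2 * pi) / sqrt (s\<^sup>2 - r\<^sup>2))
      = s\<^sup>2 / sqrt ((s\<^sup>2 - \<rho>)\<^sup>2 - (s\<^sup>2 - \<sigma>\<^sup>2 - \<tau>2)\<^sup>2)"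
  proof -
    have "(s\<^sup>2 - \<rho>)\<^sup>2 - (s\<^sup>2 - \<sigma>\<^sup>2 - \<tau>2)\<^sup>2 = t\<^sup>2 * (2 * (s\<^sup>2 - r\<^sup>2))"
      unfolding r2 t2 by (simp add: power2_eq_square field_simps)
    then have "sqrt ((s\<^sup>2 - \<rho>)\<^sup>2 - (s\<^sup>2 - \<sigma>\<^sup>2 - \<tau>2)\<^sup>2) = t * (sqrt 2 * sqrt (s\<^sup>2 - r\<^sup>2))"
      using t by (simp add: real_sqrt_mult right_diff_distrib[symmetric] del: right_diff_distrib_numeral)
    moreover have "sqrt 2 * sqrt 2 = (2::real)" by simp
    moreover have "1 / (2 * sqrt pi * t) * (s\<^sup>2 * sqrt (2 * pi) / sqrt (s\<^sup>2 - r\<^sup>2))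
       = sqrt 2 / 2 * (s\<^sup>2 / (t * sqrt (s\<^sup>2 - r\<^sup>2)))"
      by (simp add: real_sqrt_mult mult_ac)
    moreover have "sqrt 2 / 2 = 1 / sqrt (2::real)" by (simp add: real_div_sqrt field_simps)
    ultimately show ?thesis by simp
  qed
  finally show ?thesis .
qed

section \<open>From second moments to the length of an interval\<close>

text \<open>The second-moment method: the average of the laws \<open>P f\<close> has density \<open>R\<close>, the average of the \<open>L f\<close>,
  and the hypothesis on \<open>V\<close> says that \<open>\<integral> R\<^sup>2 \<partial>Q \<le> 1 + \<epsilon>\<^sup>2\<close>. Hence the variance of \<open>R\<close> is at most \<open>\<epsilon>\<^sup>2\<close> and its mean
  deviation from 1 at most \<open>\<epsilon>\<close>.\<close>

lemma average_density_close:
  fixes L :: "'i \<Rightarrow> 'a \<Rightarrow> real"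
  assumes Q: "prob_space Q" and F: "finite F" "F \<noteq> {}" and \<epsilon>: "0 < \<epsilon>"
    and L[measurable]: "\<And>f. f \<in> F \<Longrightarrow> L f \<in> borel_measurable Q" and L0: "\<And>f z. 0 \<le> L f z"
    and P: "\<And>f. f \<in> F \<Longrightarrow> P f = density Q (\<lambda>z. ennreal (L f z))"
    and prob: "\<And>f. f \<in> F \<Longrightarrow> prob_space (P f)"
    and mom: "\<And>f g. f \<in> F \<Longrightarrow> g \<in> F \<Longrightarrow> (\<integral>\<^sup>+z. ennreal (L f z) * ennreal (L g z) \<partial>Q) \<le> ennreal (V f g)"
    and V0: "\<And>f g. 0 \<le> V f g"
    and V: "(\<Sum>f\<in>F. \<Sum>g\<in>F. V f g) \<le> (1 + \<epsilon>\<^sup>2) * (real (card F))\<^sup>2"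
    and A[measurable]: "A \<in> sets Q"
  shows "\<bar>(\<Sum>f\<in>F. measure (P f) A) / card F - measure Q A\<bar> \<le> \<epsilon>"
proof -
  interpret Q: prob_space Q by (rule Q)
  define W where "W = real (card F)"
  have W: "0 < W" using F by (simp add: W_def card_gt_0_iff)
  have L1: "(\<integral>\<^sup>+z. ennreal (L f z) \<partial>Q) = ennreal 1" if "f \<in> F" for f
    using prob_space.emeasure_space_1[OF prob[OF that]] that
    by (simp add: P emeasure_density cong: nn_integral_cong)
  have intL: "has_bochner_integral Q (L f) 1" if "f \<in> F" for f
    using that L1[OF that] by (intro has_bochner_integral_nn_integral) (auto simp: L0)
  have intLL: "integrable Q (\<lambda>z. L f z * L g z)" and intLLV: "(LINT z|Q. L f z * L g z) \<le> V f g"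
    if "f \<in> F" "g \<in> F" for f g
  proof -
    have le: "(\<integral>\<^sup>+z. ennreal (L f z * L g z) \<partial>Q) \<le> ennreal (V f g)"
      using mom[OF that] by (simp add: ennreal_mult L0)
    then show i: "integrable Q (\<lambda>z. L f z * L g z)"
      using that by (intro integrableI_nonneg) (auto simp: L0 le_less_trans[OF _ ennreal_less_top])
    then show "(LINT z|Q. L f z * L g z) \<le> V f g"
      using le V0 by (simp add: nn_integral_eq_integral L0)
  qed
  have PA: "measure (P f) A = (LINT z|Q. L f z * indicator A z)" if "f \<in> F" for f
  proof -
    have "emeasure (P f) A = (\<integral>\<^sup>+z. ennreal (L f z * indicator A z) \<partial>Q)"
      using that by (simp add: P emeasure_density ennreal_mult' ennreal_indicator L0)
    also have "\<dots> = ennreal (LINT z|Q. L f z * indicator A z)"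
      using that intL[OF that] by (intro nn_integral_eq_integral integrable_real_mult_indicator)
        (auto simp: L0 has_bochner_integral_iff)
    finally show ?thesis by (simp add: measure_def integral_nonneg_AE L0)
  qed
  define R where "R z = (\<Sum>f\<in>F. L f z) / W" for z
  have Rm[measurable]: "R \<in> borel_measurable Q" unfolding R_def by measurable
  have iR: "has_bochner_integral Q R 1"
  proof -
    have "has_bochner_integral Q R ((\<Sum>f\<in>F. 1) / W)"
      unfolding R_def by (intro has_bochner_integral_divide_zero has_bochner_integral_sum intL) auto
    then show ?thesis using W by (simp add: W_def)
  qed
  have RR: "(R z)\<^sup>2 = (\<Sum>f\<in>F. \<Sum>g\<in>F. L f z * L g z) / W\<^sup>2" for z
    by (simp add: R_def power_divide power2_eq_square sum_product)
  have iRR: "integrable Q (\<lambda>z. (R z)\<^sup>2)"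
    unfolding RR by (intro integrable_divide_zero Bochner_Integration.integrable_sum intLL) auto
  have "(LINT z|Q. (R z)\<^sup>2) = (\<Sum>f\<in>F. \<Sum>g\<in>F. LINT z|Q. L f z * L g z) / W\<^sup>2"
    unfolding RR by (simp add: Bochner_Integration.integral_sum intLL Bochner_Integration.integrable_sum)
  also have "\<dots> \<le> (\<Sum>f\<in>F. \<Sum>g\<in>F. V f g) / W\<^sup>2"
    by (intro divide_right_mono sum_mono intLLV) auto
  also have "\<dots> \<le> (1 + \<epsilon>\<^sup>2) * W\<^sup>2 / W\<^sup>2"
    using V by (intro divide_right_mono) (auto simp: W_def)
  finally have RR_le: "(LINT z|Q. (R z)\<^sup>2) \<le> 1 + \<epsilon>\<^sup>2" using W by simp
  have iR': "integrable Q R" "(LINT z|Q. R z) = 1" using iR by (auto simp: has_bochner_integral_iff)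
  have "(\<Sum>f\<in>F. measure (P f) A) / W - measure Q A = (LINT z|Q. (R z - 1) * indicator A z)"
  proof -
    have "(\<Sum>f\<in>F. measure (P f) A) / W = (LINT z|Q. (\<Sum>f\<in>F. L f z * indicator A z) / W)"
      using intL by (simp add: PA has_bochner_integral_iff integrable_real_mult_indicator)
    also have "(\<lambda>z. (\<Sum>f\<in>F. L f z * indicator A z) / W) = (\<lambda>z. R z * indicator A z)"
      by (simp add: R_def sum_distrib_right)
    finally have "(\<Sum>f\<in>F. measure (P f) A) / W = (LINT z|Q. R z * indicator A z)" .
    moreover have "(LINT z|Q. (R z - 1) * indicator A z)
        = (LINT z|Q. R z * indicator A z) - (LINT z|Q. indicator A z)"
      unfolding left_diff_distrib mult_1
      by (intro Bochner_Integration.integral_diff integrable_real_mult_indicator iR' A)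
         (simp add: Q.emeasure_eq_measure)
    ultimately show ?thesis by simp
  qed
  also have "\<bar>\<dots>\<bar> \<le> (LINT z|Q. \<epsilon> / 2 + ((R z)\<^sup>2 - 2 * R z + 1) / (2 * \<epsilon>))"
  proof (rule order_trans[OF integral_abs_bound integral_mono])
    show "integrable Q (\<lambda>z. \<bar>(R z - 1) * indicator A z\<bar>)"
      using iR' by (intro integrable_abs integrable_real_mult_indicator) auto
    show "integrable Q (\<lambda>z. \<epsilon> / 2 + ((R z)\<^sup>2 - 2 * R z + 1) / (2 * \<epsilon>))"
      using iR' iRR by auto
    fix z
    \<comment> \<open>A pointwise form of the Cauchy-Schwarz inequality, with the weight that is optimal for variance \<open>\<epsilon>\<^sup>2\<close>.\<close>
    have "0 \<le> (\<bar>R z - 1\<bar> - \<epsilon>)\<^sup>2 / (2 * \<epsilon>)" using \<epsilon> by simp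
    also have "\<dots> = \<epsilon> / 2 + ((R z)\<^sup>2 - 2 * R z + 1) / (2 * \<epsilon>) - \<bar>R z - 1\<bar>"
      using \<epsilon> by (simp add: power2_diff field_simps power2_eq_square)
    finally show "\<bar>(R z - 1) * indicator A z\<bar> \<le> \<epsilon> / 2 + ((R z)\<^sup>2 - 2 * R z + 1) / (2 * \<epsilon>)"
      by (auto simp: indicator_def)
  qed
  also have "\<dots> = \<epsilon> / 2 + ((LINT z|Q. (R z)\<^sup>2) - 1) / (2 * \<epsilon>)"
    using iR' iRR Q.prob_space by simp
  also have "\<dots> \<le> \<epsilon> / 2 + \<epsilon>\<^sup>2 / (2 * \<epsilon>)"
    using RR_le \<epsilon> by (intro add_left_mono divide_right_mono) auto
  also have "\<dots> = \<epsilon>" using \<epsilon> by (simp add: power2_eq_square)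
  finally show ?thesis unfolding W_def .
qed

text \<open>Under the second family the upper end of the interval exceeds \<open>b\<close> with high probability. As the
  averages over the families nearly coincide, this persists for at least one member of the first
  family, whose interval must also reach down to \<open>a\<close>; that interval is longer than \<open>b - a\<close> with
  probability \<open>1 - 2\<alpha> - \<delta>\<close>. Only the two one-sided events are used, so the target may vary within a
  family.\<close>

lemma expected_length_lower_bound:
  fixes l u :: "'a \<Rightarrow> real"
  assumes F: "finite F" "F \<noteq> {}" and G: "finite G" "G \<noteq> {}"
    and PF: "\<And>f. f \<in> F \<Longrightarrow> prob_space (P f)" and PG: "\<And>g. g \<in> G \<Longrightarrow> prob_space (P' g)"
    and sF: "\<And>f. f \<in> F \<Longrightarrow> sets (P f) = sets M" and sG: "\<And>g. g \<in> G \<Longrightarrow> sets (P' g) = sets M"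
    and [measurable]: "l \<in> borel_measurable M" "u \<in> borel_measurable M"
    and lu: "\<And>z. z \<in> space M \<Longrightarrow> l z \<le> u z"
    and close: "\<And>A. A \<in> sets M \<Longrightarrow>
        (\<Sum>g\<in>G. measure (P' g) A) / card G \<le> (\<Sum>f\<in>F. measure (P f) A) / card F + \<delta>"
    and covF: "\<And>f. f \<in> F \<Longrightarrow> 1 - \<alpha> \<le> measure (P f) {z \<in> space M. l z \<le> a}"
    and covG: "\<And>g. g \<in> G \<Longrightarrow> 1 - \<alpha> \<le> measure (P' g) {z \<in> space M. b \<le> u z}"
    and ab: "a \<le> b"
  shows "\<exists>f\<in>F. ennreal ((b - a) * (1 - 2 * \<alpha> - \<delta>)) \<le> (\<integral>\<^sup>+z. ennreal (u z - l z) \<partial>P f)"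
proof -
  let ?A = "{z \<in> space M. l z \<le> a}" and ?B = "{z \<in> space M. b \<le> u z}"
  have AB[measurable]: "?A \<in> sets M" "?B \<in> sets M" by measurable
  have cF: "0 < real (card F)" and cG: "0 < real (card G)" using F G by (auto simp: card_gt_0_iff)
  have "1 - \<alpha> \<le> (\<Sum>g\<in>G. measure (P' g) ?B) / card G"
    using sum_bounded_below[of G "1 - \<alpha>" "\<lambda>g. measure (P' g) ?B"] covG cG by (simp add: field_simps)
  also note close[OF AB(2)]
  finally have avg: "(1 - \<alpha> - \<delta>) * card F \<le> (\<Sum>f\<in>F. measure (P f) ?B)"
    using cF by (simp add: field_simps)
  have "\<exists>f\<in>F. 1 - \<alpha> - \<delta> \<le> measure (P f) ?B"
  proof (rule ccontr)
    assume "\<not> ?thesis"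
    then have "(\<Sum>f\<in>F. measure (P f) ?B) < (\<Sum>f\<in>F. 1 - \<alpha> - \<delta>)"
      using F by (intro sum_strict_mono) auto
    with avg show False by (simp add: mult.commute)
  qed
  then obtain f where f: "f \<in> F" "1 - \<alpha> - \<delta> \<le> measure (P f) ?B" by auto
  interpret prob_space "P f" by (rule PF) fact
  have sp: "space (P f) = space M" using sF[OF f(1)] by (rule sets_eq_imp_space_eq)
  have ev: "?A \<in> events" "?B \<in> events" using AB sF[OF f(1)] by auto
  have "prob (?A \<union> ?B) \<le> 1" by (rule prob_le_1)
  moreover have "prob (?A \<union> ?B) = prob ?A + prob ?B - prob (?A \<inter> ?B)"
    using measure_Un3[of ?A "P f" ?B] ev by (auto simp: fmeasurable_eq_sets)
  ultimately have AiB: "1 - 2 * \<alpha> - \<delta> \<le> prob (?A \<inter> ?B)"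
    using f(2) covF[OF f(1)] by linarith
  have "ennreal ((b - a) * (1 - 2 * \<alpha> - \<delta>)) \<le> ennreal ((b - a) * prob (?A \<inter> ?B))"
    using ab AiB by (intro ennreal_leI mult_left_mono) auto
  also have "\<dots> = (\<integral>\<^sup>+z. ennreal (b - a) * indicator (?A \<inter> ?B) z \<partial>P f)"
    using ab ev by (subst nn_integral_cmult_indicator) (auto simp: ennreal_mult emeasure_eq_measure)
  also have "\<dots> \<le> (\<integral>\<^sup>+z. ennreal (u z - l z) \<partial>P f)"
    by (intro nn_integral_mono) (auto simp: sp indicator_def intro!: ennreal_leI)
  finally show ?thesis using f(1) by blast
qed

section \<open>Sparse vectors with random support\<close>

lemma exp_le_one_minus:
  fixes x :: real
  assumes "0 \<le> x" "x \<le> 1 / 2"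
  shows "exp (- 2 * x) \<le> 1 - x"
proof -
  have "- 2 * x \<le> - x - 2 * x\<^sup>2"
    using mult_left_mono[OF assms(2) assms(1)] by (simp add: power2_eq_square)
  also have "\<dots> \<le> ln (1 - x)" using assms by (rule ln_one_minus_pos_lower_bound)
  finally have "exp (- 2 * x) \<le> exp (ln (1 - x))" by simp
  then show ?thesis using assms by simp
qed

text \<open>The exact second moment separates into a factor for the overlap \<open>\<rho>\<close> and one for the variance
  mismatch \<open>D\<close>, the latter entering only quadratically. This is why a mismatch of order \<open>n powr (-1/2)\<close> stays
  invisible in \<open>n\<close> observations.\<close>

lemma second_moment_bound:
  fixes a \<rho> D :: real
  assumes a: "0 < a" and \<rho>: "0 \<le> \<rho>" "\<rho> \<le> a / 2" and D: "\<bar>D\<bar> \<le> a / 4"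
  shows "a / sqrt ((a - \<rho>)\<^sup>2 - D\<^sup>2) \<le> exp (2 * \<rho> / a + 4 * (D / a)\<^sup>2)"
proof -
  define x where "x = \<rho> / a"
  define y where "y = (D / (a - \<rho>))\<^sup>2"
  have x: "0 \<le> x" "x \<le> 1 / 2" using a \<rho> by (auto simp: x_def field_simps)
  have a\<rho>: "a / 2 \<le> a - \<rho>" "0 < a - \<rho>" using a \<rho> by auto
  have "\<bar>D / (a - \<rho>)\<bar> \<le> 2 * \<bar>D / a\<bar>"
  proof -
    have "\<bar>D / (a - \<rho>)\<bar> = \<bar>D\<bar> / (a - \<rho>)" using a\<rho> by simp
    also have "\<dots> \<le> \<bar>D\<bar> / (a / 2)" using a\<rho> a by (intro divide_left_mono) auto
    finally show ?thesis using a by (simp add: mult.commute)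
  qed
  then have "y \<le> (2 * \<bar>D / a\<bar>)\<^sup>2"
    unfolding y_def by (simp add: abs_le_square_iff[symmetric])
  then have y4: "y \<le> 4 * (D / a)\<^sup>2" by (simp only: power_mult_distrib power2_abs) simp
  have "\<bar>D / a\<bar> \<le> 1 / 4" using D a by (simp add: field_simps)
  then have "(D / a)\<^sup>2 \<le> (1 / 4)\<^sup>2" by (simp add: abs_le_square_iff[symmetric])
  moreover have "(1 / 4)\<^sup>2 = (1 / 16 :: real)" by (simp add: power2_eq_square)
  ultimately have "y \<le> 1 / 2" using y4 by linarith
  then have y: "0 \<le> y" "y \<le> 1 / 2" by (simp_all add: y_def)
  have "exp (- (2 * x + y)) = exp (- 2 * x) * sqrt (exp (- 2 * y))"
  proof -
    have "sqrt (exp (- 2 * y)) = exp (- y)"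
      by (rule real_sqrt_unique) (simp_all add: power2_eq_square flip: exp_add)
    then show ?thesis by (simp flip: exp_add)
  qed
  also have "\<dots> \<le> (1 - x) * sqrt (1 - y)"
    using x y by (intro mult_mono exp_le_one_minus real_sqrt_le_mono) auto
  also have "\<dots> = sqrt (((a - \<rho>)\<^sup>2 - D\<^sup>2) / a\<^sup>2)"
  proof -
    have "((a - \<rho>)\<^sup>2 - D\<^sup>2) / a\<^sup>2 = (1 - x)\<^sup>2 * (1 - y)"
      unfolding x_def y_def power_divide using a a\<rho> by (simp add: field_simps)
    then show ?thesis using x by (simp add: real_sqrt_mult)
  qed
  also have "\<dots> = sqrt ((a - \<rho>)\<^sup>2 - D\<^sup>2) / a"
    using a by (simp add: real_sqrt_divide)
  finally have key: "exp (- (2 * x + y)) \<le> sqrt ((a - \<rho>)\<^sup>2 - D\<^sup>2) / a" .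
  have "a / sqrt ((a - \<rho>)\<^sup>2 - D\<^sup>2) = inverse (sqrt ((a - \<rho>)\<^sup>2 - D\<^sup>2) / a)"
    by simp
  also have "\<dots> \<le> inverse (exp (- (2 * x + y)))"
    using key by (intro le_imp_inverse_le) auto
  also have "\<dots> = exp (2 * x + y)" by (simp flip: exp_minus)
  also have "\<dots> \<le> exp (2 * x + 4 * (D / a)\<^sup>2)" using y4 by simp
  finally show ?thesis by (simp add: x_def)
qed

text \<open>For a fixed \<open>f\<close> the sum over \<open>g\<close> factorizes over the blocks: the number of agreements of two uniform
  draws is binomial with success probability \<open>1 / B\<close>, and this is its generating function.\<close>

lemma sum_power_agreements:
  fixes x :: real and K B :: nat
  assumes B: "0 < B"
  defines "F \<equiv> PiE {..<K} (\<lambda>_. {..<B})"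
  shows "(\<Sum>f\<in>F. \<Sum>g\<in>F. x ^ card {i \<in> {..<K}. f i = g i}) = (1 + (x - 1) / real B) ^ K * (real (card F))\<^sup>2"
proof -
  have card: "real (card F) = real B ^ K" unfolding F_def by (simp add: card_PiE)
  have inner: "(\<Sum>g\<in>F. x ^ card {i \<in> {..<K}. f i = g i}) = (1 + (x - 1) / real B) ^ K * real (card F)"
    if f: "f \<in> F" for f
  proof -
    have "(\<Sum>g\<in>F. x ^ card {i \<in> {..<K}. f i = g i}) = (\<Sum>g\<in>F. \<Prod>i<K. if f i = g i then x else 1)"
    proof (rule sum.cong[OF refl])
      fix g
      have "(\<Prod>i<K. if f i = g i then x else 1) = (\<Prod>i\<in>{i \<in> {..<K}. f i = g i}. x)"
        by (rule prod.inter_filter[symmetric]) simp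
      then show "x ^ card {i \<in> {..<K}. f i = g i} = (\<Prod>i<K. if f i = g i then x else 1)"
        by simp
    qed
    also have "\<dots> = (\<Prod>i<K. \<Sum>y<B. if f i = y then x else 1)"
      unfolding F_def by (rule prod_sum_PiE[symmetric]) auto
    also have "\<dots> = (\<Prod>i<K. real B * (1 + (x - 1) / real B))"
    proof (rule prod.cong[OF refl])
      fix i assume "i \<in> {..<K}"
      then have fi: "f i < B" using f by (auto simp: F_def PiE_def Pi_def)
      have "(\<Sum>y<B. if f i = y then x else 1) = (\<Sum>y<B. 1 + (if f i = y then x - 1 else 0))"
        by (intro sum.cong) auto
      also have "\<dots> = real B + (x - 1)" using fi by (simp only: sum.distrib sum.delta) simp
      also have "\<dots> = real B * (1 + (x - 1) / real B)" using B by (simp add: field_simps)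
      finally show "(\<Sum>y<B. if f i = y then x else 1) = real B * (1 + (x - 1) / real B)" .
    qed
    finally show ?thesis by (simp add: card power_mult_distrib)
  qed
  have "(\<Sum>f\<in>F. \<Sum>g\<in>F. x ^ card {i \<in> {..<K}. f i = g i}) = (\<Sum>f\<in>F. (1 + (x - 1) / real B) ^ K * real (card F))"
    by (rule sum.cong[OF refl inner])
  then show ?thesis by (simp add: power2_eq_square mult_ac)
qed

text \<open>The conditions under which \<open>K\<close> coordinates of size \<open>\<bar>d\<bar>\<close>, placed at random among \<open>q\<close>, cannot be
  detected in \<open>n\<close> observations: the averaged law is within \<open>\<epsilon>\<close>, uniformly over events, of pure noise of
  variance \<open>s\<^sup>2\<close>. In the last conjunct, which bounds one plus the chi-square divergence, the first
  factor is the price of the mismatch between \<open>s\<^sup>2\<close> and the true variance \<open>\<sigma>\<^sup>2 + K d\<^sup>2\<close> of a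
  response; the second is the average over two independent draws of the price of their overlap. The
  first conjunct makes the blocks nonempty, the next two keep the second moments finite.\<close>

definition prior_hidden :: "nat \<Rightarrow> nat \<Rightarrow> real \<Rightarrow> real \<Rightarrow> real \<Rightarrow> nat \<Rightarrow> real \<Rightarrow> bool" where
  "prior_hidden n q \<sigma> s \<epsilon> K d \<longleftrightarrow>
     0 < q div K \<and> real K * d\<^sup>2 \<le> s\<^sup>2 / 2 \<and> \<bar>s\<^sup>2 - \<sigma>\<^sup>2 - real K * d\<^sup>2\<bar> \<le> s\<^sup>2 / 4 \<and>
     exp (4 * real n * ((s\<^sup>2 - \<sigma>\<^sup>2 - real K * d\<^sup>2) / s\<^sup>2)\<^sup>2)
       * (1 + (exp (2 * real n * d\<^sup>2 / s\<^sup>2) - 1) / real (q div K)) ^ K \<le> 1 + \<epsilon>\<^sup>2"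

definition signed_indicator :: "real vec \<Rightarrow> real \<Rightarrow> nat set \<Rightarrow> real vec" where
  "signed_indicator \<xi> d S = vec (dim_vec \<xi>) (\<lambda>j. if j \<in> S then d * sgn (vec_index \<xi> j) else 0)"

lemma finite_supp_vec: "finite (supp_vec \<xi>)"
  by (rule finite_subset[of _ "{..<dim_vec \<xi>}"]) (auto simp: supp_vec_def)

context
  fixes \<xi> :: "real vec" and p :: nat
  assumes \<xi>: "\<xi> \<in> carrier_vec p"
begin

lemma signed_indicator_carrier: "signed_indicator \<xi> d S \<in> carrier_vec p"
  using \<xi> by (simp add: signed_indicator_def)

lemma signed_indicator_index: "j < p \<Longrightarrow> vec_index (signed_indicator \<xi> d S) j = (if j \<in> S then d * sgn (vec_index \<xi> j) else 0)"
  using \<xi> by (simp add: signed_indicator_def)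

lemma supp_subset: "S \<subseteq> supp_vec \<xi> \<Longrightarrow> S \<subseteq> {..<p}"
  using \<xi> by (auto simp: supp_vec_def)

lemma l0_norm_signed_indicator:
  assumes S: "S \<subseteq> supp_vec \<xi>"
  shows "l0_norm (signed_indicator \<xi> d S) \<le> card S"
  unfolding l0_norm_def
proof (rule card_mono)
  show "finite S" using S finite_supp_vec by (rule finite_subset)
  show "supp_vec (signed_indicator \<xi> d S) \<subseteq> S"
    by (auto simp: supp_vec_def signed_indicator_def split: if_splits)
qed

lemma sum_signed_indicator:
  assumes S: "S \<subseteq> supp_vec \<xi>" and T: "T \<subseteq> supp_vec \<xi>"
  shows "(\<Sum>j<p. vec_index (signed_indicator \<xi> d S) j * vec_index (signed_indicator \<xi> d T) j) = real (card (S \<inter> T)) * d\<^sup>2"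
proof -
  have "(\<Sum>j<p. vec_index (signed_indicator \<xi> d S) j * vec_index (signed_indicator \<xi> d T) j)
      = (\<Sum>j<p. if j \<in> S \<inter> T then d\<^sup>2 else 0)"
  proof (rule sum.cong[OF refl])
    fix j assume j: "j \<in> {..<p}"
    have "sgn (vec_index \<xi> j) * sgn (vec_index \<xi> j) = 1" if "j \<in> S"
      using that S by (auto simp: supp_vec_def sgn_if)
    then show "vec_index (signed_indicator \<xi> d S) j * vec_index (signed_indicator \<xi> d T) j = (if j \<in> S \<inter> T then d\<^sup>2 else 0)"
      using j by (auto simp: signed_indicator_index power2_eq_square mult_ac)
  qed
  also have "\<dots> = (\<Sum>j\<in>S \<inter> T. d\<^sup>2)"
    using supp_subset[OF S] by (intro sum.mono_neutral_cong_right) auto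
  finally show ?thesis by simp
qed

lemma scalar_prod_signed_indicator:
  assumes S: "S \<subseteq> supp_vec \<xi>"
  shows "scalar_prod \<xi> (signed_indicator \<xi> d S) = d * (\<Sum>j\<in>S. \<bar>vec_index \<xi> j\<bar>)"
proof -
  have "scalar_prod \<xi> (signed_indicator \<xi> d S) = (\<Sum>j<p. if j \<in> S then d * \<bar>vec_index \<xi> j\<bar> else 0)"
    using \<xi> by (auto simp: scalar_prod_def signed_indicator_def lessThan_atLeast0 sgn_if intro!: sum.cong)
  also have "\<dots> = (\<Sum>j\<in>S. d * \<bar>vec_index \<xi> j\<bar>)"
    using supp_subset[OF S] by (intro sum.mono_neutral_cong_right) auto
  finally show ?thesis by (simp add: sum_distrib_left)
qed

text \<open>The support is drawn by splitting \<open>K\<close> blocks of size \<open>B\<close> off \<open>supp \<xi>\<close> and picking one coordinate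
  in each, independently and uniformly, so that the draws are the functions in
  \<open>{..<K} \<rightarrow> {..<B}\<close>. Compared with a uniformly random \<open>K\<close>-subset this loses
  nothing in the rate, and the overlap of two draws is the number of blocks in which they agree, a
  sum of independent indicators.\<close>

lemma random_support_close:
  assumes \<sigma>: "0 < \<sigma>" and s: "0 < s" and \<epsilon>: "0 < \<epsilon>"
    and hidden: "prior_hidden n (card (supp_vec \<xi>)) \<sigma> s \<epsilon> K d"
  obtains F :: "(nat \<Rightarrow> nat) set" and S :: "(nat \<Rightarrow> nat) \<Rightarrow> nat set"
  where "finite F" "F \<noteq> {}" "\<And>f. f \<in> F \<Longrightarrow> S f \<subseteq> supp_vec \<xi>" "\<And>f. f \<in> F \<Longrightarrow> card (S f) = K"
    "\<And>A. A \<in> sets (data_space n p) \<Longrightarrow>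
       \<bar>(\<Sum>f\<in>F. measure (data_law n p (signed_indicator \<xi> d (S f), 1\<^sub>m p, \<sigma>)) A) / card F
          - measure (data_law n p (0\<^sub>v p, 1\<^sub>m p, s)) A\<bar> \<le> \<epsilon>"
proof -
  define B where "B = card (supp_vec \<xi>) div K"
  have B: "0 < B" and KB: "K * B \<le> card (supp_vec \<xi>)"
    and small: "real K * d\<^sup>2 \<le> s\<^sup>2 / 2" and mismatch: "\<bar>s\<^sup>2 - \<sigma>\<^sup>2 - real K * d\<^sup>2\<bar> \<le> s\<^sup>2 / 4"
    and moment: "exp (4 * real n * ((s\<^sup>2 - \<sigma>\<^sup>2 - real K * d\<^sup>2) / s\<^sup>2)\<^sup>2)
              * (1 + (exp (2 * real n * d\<^sup>2 / s\<^sup>2) - 1) / real B) ^ K \<le> 1 + \<epsilon>\<^sup>2"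
    using hidden by (simp_all add: prior_hidden_def B_def)
  obtain h where h: "bij_betw h {0..<card (supp_vec \<xi>)} (supp_vec \<xi>)"
    using ex_bij_betw_nat_finite[OF finite_supp_vec] by blast
  define e where "e i j = h (i * B + j)" for i j
  have enc: "i * B + j < card (supp_vec \<xi>)" if "i < K" "j < B" for i j
  proof -
    have "i * B + j < Suc i * B" using that by simp
    also have "\<dots> \<le> K * B" using that by (intro mult_right_mono) auto
    finally show ?thesis using KB by simp
  qed
  have e_supp: "e i j \<in> supp_vec \<xi>" if "i < K" "j < B" for i j
    using bij_betwE[OF h] enc[OF that] by (auto simp: e_def)
  have e_inj: "i = i' \<and> j = j'" if "i < K" "j < B" "i' < K" "j' < B" "e i j = e i' j'" for i j i' j'
  proof -
    have eq: "i * B + j = i' * B + j'"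
      using h that enc[of i j] enc[of i' j'] by (auto simp: e_def bij_betw_def inj_on_def)
    then have "(i * B + j) div B = (i' * B + j') div B" "(i * B + j) mod B = (i' * B + j') mod B" by simp_all
    then show ?thesis using that B by simp
  qed
  define F where "F = PiE {..<K} (\<lambda>_. {..<B})"
  define S where "S f = (\<lambda>i. e i (f i)) ` {..<K}" for f
  have Fi: "f i < B" if "f \<in> F" "i < K" for f i using that by (auto simp: F_def PiE_def Pi_def)
  have finF: "finite F" unfolding F_def by (intro finite_PiE) auto
  have neF: "F \<noteq> {}" unfolding F_def PiE_eq_empty_iff using B by auto
  have Ssub: "S f \<subseteq> supp_vec \<xi>" if "f \<in> F" for f
    using e_supp Fi[OF that] by (auto simp: S_def)
  have inj: "inj_on (\<lambda>i. e i (f i)) {..<K}" if "f \<in> F" for f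
    by (intro inj_onI) (metis e_inj Fi[OF that] lessThan_iff)
  have cardS: "card (S f) = K" if "f \<in> F" for f
    unfolding S_def using card_image[OF inj[OF that]] by simp
  have cardI: "card (S f \<inter> S g) = card {i \<in> {..<K}. f i = g i}" if "f \<in> F" "g \<in> F" for f g
  proof -
    have "S f \<inter> S g = (\<lambda>i. e i (f i)) ` {i \<in> {..<K}. f i = g i}"
    proof (intro equalityI subsetI)
      fix y assume "y \<in> S f \<inter> S g"
      then obtain i i' where "i < K" "i' < K" "y = e i (f i)" "y = e i' (g i')" by (auto simp: S_def)
      then show "y \<in> (\<lambda>i. e i (f i)) ` {i \<in> {..<K}. f i = g i}"
        using e_inj[of i "f i" i' "g i'"] Fi that by auto
    next
      fix y assume "y \<in> (\<lambda>i. e i (f i)) ` {i \<in> {..<K}. f i = g i}"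
      then obtain i where "i < K" "f i = g i" "y = e i (f i)" by auto
      then show "y \<in> S f \<inter> S g" unfolding S_def by (intro IntI image_eqI[of _ _ i]) auto
    qed
    then show ?thesis
      using card_image[OF inj_on_subset[OF inj[OF that(1)]], of "{i \<in> {..<K}. f i = g i}"] by auto
  qed
  define D where "D = s\<^sup>2 - \<sigma>\<^sup>2 - real K * d\<^sup>2"
  define V where "V f g = exp (4 * real n * (D / s\<^sup>2)\<^sup>2) * exp (2 * real n * d\<^sup>2 / s\<^sup>2) ^ card {i \<in> {..<K}. f i = g i}" for f g :: "nat \<Rightarrow> nat"
  let ?L = "\<lambda>f z. \<Prod>i<n. lik_ratio p (signed_indicator \<xi> d (S f)) \<sigma> s (z i)"
  have s2: "0 < s\<^sup>2" using s by simp
  have sets_Q: "sets (data_law n p (0\<^sub>v p, 1\<^sub>m p, s)) = sets (data_space n p)"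
    by (simp add: data_law_def)
  have "\<bar>(\<Sum>f\<in>F. measure (data_law n p (signed_indicator \<xi> d (S f), 1\<^sub>m p, \<sigma>)) A) / card F
          - measure (data_law n p (0\<^sub>v p, 1\<^sub>m p, s)) A\<bar> \<le> \<epsilon>"
    if A: "A \<in> sets (data_space n p)" for A
  proof (rule average_density_close[where L = ?L and V = V])
    show "prob_space (data_law n p (0\<^sub>v p, 1\<^sub>m p, s))"
      by (simp add: data_law_eq_PiM s prob_space_PiM prob_space_obs_law)
    show "prob_space (data_law n p (signed_indicator \<xi> d (S f), 1\<^sub>m p, \<sigma>))" for f
      by (simp add: data_law_eq_PiM \<sigma> prob_space_PiM prob_space_obs_law signed_indicator_carrier)
    show "data_law n p (signed_indicator \<xi> d (S f), 1\<^sub>m p, \<sigma>)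
        = density (data_law n p (0\<^sub>v p, 1\<^sub>m p, s)) (\<lambda>z. ennreal (?L f z))" for f
      by (rule data_law_eq_density[OF signed_indicator_carrier \<sigma> s])
    show "?L f \<in> borel_measurable (data_law n p (0\<^sub>v p, 1\<^sub>m p, s))" for f
      unfolding measurable_cong_sets[OF sets_Q refl] data_space_def
      by measurable
    show "0 \<le> ?L f z" for f z by (simp add: prod_nonneg)
    show "0 \<le> V f g" for f g by (simp add: V_def)
    show "(\<integral>\<^sup>+z. ennreal (?L f z) * ennreal (?L g z) \<partial>data_law n p (0\<^sub>v p, 1\<^sub>m p, s)) \<le> ennreal (V f g)"
      if f: "f \<in> F" and g: "g \<in> F" for f g
    proof -
      define \<rho> where "\<rho> = real (card {i \<in> {..<K}. f i = g i}) * d\<^sup>2"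
      have "card {i \<in> {..<K}. f i = g i} \<le> card {..<K}" by (intro card_mono) auto
      then have \<rho>K: "\<rho> \<le> real K * d\<^sup>2" unfolding \<rho>_def by (intro mult_right_mono) auto
      have \<rho>0: "0 \<le> \<rho>" by (simp add: \<rho>_def)
      have "(\<integral>\<^sup>+z. ennreal (?L f z) * ennreal (?L g z) \<partial>data_law n p (0\<^sub>v p, 1\<^sub>m p, s))
          = (ennreal (s\<^sup>2 / sqrt ((s\<^sup>2 - \<rho>)\<^sup>2 - D\<^sup>2))) ^ n"
        unfolding nn_integral_lik_ratio_product[OF s] D_def
      proof (rule arg_cong[where f = "\<lambda>x. x ^ n"], rule nn_integral_lik_ratio_pair[OF \<sigma> s])
        show "vec_index (signed_indicator \<xi> d (S f)) j = vec_index (signed_indicator \<xi> d (S g)) j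
            \<or> vec_index (signed_indicator \<xi> d (S f)) j = 0 \<or> vec_index (signed_indicator \<xi> d (S g)) j = 0" if "j < p" for j
          using that by (simp add: signed_indicator_index)
        show "(\<Sum>j<p. (vec_index (signed_indicator \<xi> d (S f)) j)\<^sup>2) = real K * d\<^sup>2"
          using sum_signed_indicator[OF Ssub[OF f] Ssub[OF f]] by (simp add: power2_eq_square cardS[OF f])
        show "(\<Sum>j<p. (vec_index (signed_indicator \<xi> d (S g)) j)\<^sup>2) = real K * d\<^sup>2"
          using sum_signed_indicator[OF Ssub[OF g] Ssub[OF g]] by (simp add: power2_eq_square cardS[OF g])
        show "(\<Sum>j<p. vec_index (signed_indicator \<xi> d (S f)) j * vec_index (signed_indicator \<xi> d (S g)) j) = \<rho>"
          unfolding \<rho>_def cardI[OF f g, symmetric] by (rule sum_signed_indicator[OF Ssub[OF f] Ssub[OF g]])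
        show "\<bar>s\<^sup>2 - \<sigma>\<^sup>2 - real K * d\<^sup>2\<bar> < s\<^sup>2 - \<rho>"
          using mismatch small \<rho>K s2 by linarith
      qed
      also have "\<dots> \<le> ennreal (exp (2 * \<rho> / s\<^sup>2 + 4 * (D / s\<^sup>2)\<^sup>2)) ^ n"
        using second_moment_bound[OF s2 \<rho>0, of D] \<rho>K small mismatch
        by (intro power_mono ennreal_leI) (auto simp: D_def)
      also have "\<dots> = ennreal (V f g)"
      proof -
        have "exp (2 * \<rho> / s\<^sup>2 + 4 * (D / s\<^sup>2)\<^sup>2) ^ n = V f g"
          unfolding V_def \<rho>_def exp_of_nat_mult[symmetric] exp_add[symmetric]
          by (simp add: algebra_simps add_divide_distrib)
        then show ?thesis by (simp add: ennreal_power)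
      qed
      finally show ?thesis .
    qed
    show "(\<Sum>f\<in>F. \<Sum>g\<in>F. V f g) \<le> (1 + \<epsilon>\<^sup>2) * (real (card F))\<^sup>2"
    proof -
      have "(\<Sum>f\<in>F. \<Sum>g\<in>F. V f g) = exp (4 * real n * (D / s\<^sup>2)\<^sup>2)
          * ((1 + (exp (2 * real n * d\<^sup>2 / s\<^sup>2) - 1) / real B) ^ K * (real (card F))\<^sup>2)"
        unfolding V_def F_def sum_power_agreements[OF B, symmetric] by (simp add: sum_distrib_left)
      also have "\<dots> \<le> (1 + \<epsilon>\<^sup>2) * (real (card F))\<^sup>2"
        using mult_right_mono[OF moment, of "(real (card F))\<^sup>2"] by (simp add: D_def mult.assoc)
      finally show ?thesis .
    qed
    show "A \<in> sets (data_law n p (0\<^sub>v p, 1\<^sub>m p, s))" using A by (simp add: sets_Q)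
  qed (use finF neF \<epsilon> in auto)
  with finF neF Ssub cardS show ?thesis by (rule that)
qed

end

section \<open>The lower bound\<close>

text \<open>With coefficients \<open>d\<^sub>0 \<le> 0\<close> the functional is at most \<open>0\<close>, with \<open>d\<^sub>1 \<ge> 0\<close> it is at least
  \<open>K\<^sub>1 d\<^sub>1 m\<close>; both families are within \<open>\<epsilon>\<close> of the same noise law and so within \<open>2\<epsilon>\<close> of each other. The
  first family lies in the small parameter space, where the length is measured, the second only in
  the large one, where coverage is required.\<close>

lemma opt_length_two_priors:
  assumes \<xi>: "\<xi> \<in> carrier_vec p" and m: "0 \<le> m" "\<And>j. j \<in> supp_vec \<xi> \<Longrightarrow> m \<le> \<bar>vec_index \<xi> j\<bar>"
    and \<sigma>: "0 < \<sigma>" and s: "0 < s" and \<epsilon>: "0 < \<epsilon>"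
    and K: "K\<^sub>0 \<le> k\<^sub>1" "k\<^sub>1 \<le> k" "K\<^sub>1 \<le> k" and d: "d\<^sub>0 \<le> 0" "0 \<le> d\<^sub>1"
    and hidden: "prior_hidden n (card (supp_vec \<xi>)) \<sigma> s \<epsilon> K\<^sub>0 d\<^sub>0"
      "prior_hidden n (card (supp_vec \<xi>)) \<sigma> s \<epsilon> K\<^sub>1 d\<^sub>1"
  shows "ennreal (real K\<^sub>1 * d\<^sub>1 * m * (1 - 2 * \<alpha> - 2 * \<epsilon>))
    \<le> opt_length n p \<alpha> (param_space p k\<^sub>1 (1\<^sub>m p) \<sigma>) (param_space p k (1\<^sub>m p) \<sigma>) (\<lambda>\<beta>. scalar_prod \<xi> \<beta>)"
  unfolding opt_length_def
proof (rule INF_greatest, clarify)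
  fix l u assume CI: "(l, u) \<in> conf_intervals n p \<alpha> (param_space p k (1\<^sub>m p) \<sigma>) (\<lambda>\<beta>. scalar_prod \<xi> \<beta>)"
  then have lu: "l \<in> borel_measurable (data_space n p)" "u \<in> borel_measurable (data_space n p)"
    "\<And>z. z \<in> space (data_space n p) \<Longrightarrow> l z \<le> u z"
    by (auto simp: conf_intervals_def)
  let ?P = "\<lambda>d S. data_law n p (signed_indicator \<xi> d S, 1\<^sub>m p, \<sigma>)"
  have sets_P: "sets (?P d S) = sets (data_space n p)" for d S by (simp add: data_law_def)
  have prob_P: "prob_space (?P d S)" for d S
    by (simp add: data_law_eq_PiM \<sigma> prob_space_PiM prob_space_obs_law signed_indicator_carrier \<xi>)
  have in_space: "(signed_indicator \<xi> d S, 1\<^sub>m p, \<sigma>) \<in> param_space p j (1\<^sub>m p) \<sigma>"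
    if "S \<subseteq> supp_vec \<xi>" "card S \<le> j" for d S j
    using that l0_norm_signed_indicator[OF \<xi> that(1), of d] signed_indicator_carrier[OF \<xi>]
    by (auto simp: param_space_def)
  have cover: "1 - \<alpha> \<le> measure (?P d S) {z \<in> space (data_space n p). Q z}"
    if S: "S \<subseteq> supp_vec \<xi>" "card S \<le> k" and Q: "{z \<in> space (data_space n p). Q z} \<in> sets (data_space n p)"
      and imp: "\<And>z. l z \<le> scalar_prod \<xi> (signed_indicator \<xi> d S) \<Longrightarrow> scalar_prod \<xi> (signed_indicator \<xi> d S) \<le> u z \<Longrightarrow> Q z"
    for d S Q
  proof -
    interpret prob_space "?P d S" by (rule prob_P)
    let ?T = "scalar_prod \<xi> (signed_indicator \<xi> d S)"
    have "ennreal (1 - \<alpha>) \<le> (INF (\<beta>, \<Omega>, \<sigma>) \<in> param_space p k (1\<^sub>m p) \<sigma>. emeasure (data_law n p (\<beta>, \<Omega>, \<sigma>))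
         {z \<in> space (data_space n p). l z \<le> scalar_prod \<xi> \<beta> \<and> scalar_prod \<xi> \<beta> \<le> u z})"
      using CI by (simp add: conf_intervals_def)
    also have "\<dots> \<le> emeasure (?P d S) {z \<in> space (data_space n p). l z \<le> ?T \<and> ?T \<le> u z}"
      using INF_lower[OF in_space[OF S], of "\<lambda>(\<beta>, \<Omega>, \<sigma>). emeasure (data_law n p (\<beta>, \<Omega>, \<sigma>))
         {z \<in> space (data_space n p). l z \<le> scalar_prod \<xi> \<beta> \<and> scalar_prod \<xi> \<beta> \<le> u z}" d] by simp
    also have "\<dots> \<le> emeasure (?P d S) {z \<in> space (data_space n p). Q z}"
      using Q imp by (intro emeasure_mono) (auto simp: sets_P)
    finally show ?thesis by (simp add: emeasure_eq_measure)
  qed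
  obtain F\<^sub>0 and S\<^sub>0 :: "(nat \<Rightarrow> nat) \<Rightarrow> nat set" where F0: "finite F\<^sub>0" "F\<^sub>0 \<noteq> {}"
    and S0: "\<And>f. f \<in> F\<^sub>0 \<Longrightarrow> S\<^sub>0 f \<subseteq> supp_vec \<xi>" "\<And>f. f \<in> F\<^sub>0 \<Longrightarrow> card (S\<^sub>0 f) = K\<^sub>0"
    and close0: "\<And>A. A \<in> sets (data_space n p) \<Longrightarrow>
       \<bar>(\<Sum>f\<in>F\<^sub>0. measure (?P d\<^sub>0 (S\<^sub>0 f)) A) / card F\<^sub>0 - measure (data_law n p (0\<^sub>v p, 1\<^sub>m p, s)) A\<bar> \<le> \<epsilon>"
    by (rule random_support_close[OF \<xi> \<sigma> s \<epsilon> hidden(1)]) blast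
  obtain F\<^sub>1 and S\<^sub>1 :: "(nat \<Rightarrow> nat) \<Rightarrow> nat set" where F1: "finite F\<^sub>1" "F\<^sub>1 \<noteq> {}"
    and S1: "\<And>f. f \<in> F\<^sub>1 \<Longrightarrow> S\<^sub>1 f \<subseteq> supp_vec \<xi>" "\<And>f. f \<in> F\<^sub>1 \<Longrightarrow> card (S\<^sub>1 f) = K\<^sub>1"
    and close1: "\<And>A. A \<in> sets (data_space n p) \<Longrightarrow>
       \<bar>(\<Sum>f\<in>F\<^sub>1. measure (?P d\<^sub>1 (S\<^sub>1 f)) A) / card F\<^sub>1 - measure (data_law n p (0\<^sub>v p, 1\<^sub>m p, s)) A\<bar> \<le> \<epsilon>"
    by (rule random_support_close[OF \<xi> \<sigma> s \<epsilon> hidden(2)]) blast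
  have T0: "scalar_prod \<xi> (signed_indicator \<xi> d\<^sub>0 (S\<^sub>0 f)) \<le> 0" if "f \<in> F\<^sub>0" for f
    unfolding scalar_prod_signed_indicator[OF \<xi> S0(1)[OF that]]
    using d by (intro mult_nonpos_nonneg sum_nonneg) auto
  have T1: "real K\<^sub>1 * d\<^sub>1 * m \<le> scalar_prod \<xi> (signed_indicator \<xi> d\<^sub>1 (S\<^sub>1 f))" if "f \<in> F\<^sub>1" for f
  proof -
    have "real K\<^sub>1 * m \<le> (\<Sum>j\<in>S\<^sub>1 f. \<bar>vec_index \<xi> j\<bar>)"
      using sum_bounded_below[of "S\<^sub>1 f" m "\<lambda>j. \<bar>vec_index \<xi> j\<bar>"] S1[OF that] m by auto
    then have "d\<^sub>1 * (real K\<^sub>1 * m) \<le> d\<^sub>1 * (\<Sum>j\<in>S\<^sub>1 f. \<bar>vec_index \<xi> j\<bar>)"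
      using d by (intro mult_left_mono) auto
    then show ?thesis
      unfolding scalar_prod_signed_indicator[OF \<xi> S1(1)[OF that]] by (simp add: mult_ac)
  qed
  note [measurable] = lu(1,2)
  have "\<exists>f\<in>F\<^sub>0. ennreal ((real K\<^sub>1 * d\<^sub>1 * m - 0) * (1 - 2 * \<alpha> - 2 * \<epsilon>))
      \<le> (\<integral>\<^sup>+z. ennreal (u z - l z) \<partial>?P d\<^sub>0 (S\<^sub>0 f))"
  proof (rule expected_length_lower_bound[OF F0 F1 prob_P prob_P sets_P sets_P lu])
    fix A assume "A \<in> sets (data_space n p)"
    from close0[OF this] close1[OF this]
    show "(\<Sum>g\<in>F\<^sub>1. measure (?P d\<^sub>1 (S\<^sub>1 g)) A) / card F\<^sub>1
        \<le> (\<Sum>f\<in>F\<^sub>0. measure (?P d\<^sub>0 (S\<^sub>0 f)) A) / card F\<^sub>0 + 2 * \<epsilon>"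
      by linarith
  next
    fix f assume f: "f \<in> F\<^sub>0"
    show "1 - \<alpha> \<le> measure (?P d\<^sub>0 (S\<^sub>0 f)) {z \<in> space (data_space n p). l z \<le> 0}"
      by (rule cover) (use S0[OF f] T0[OF f] K in auto)
  next
    fix f assume f: "f \<in> F\<^sub>1"
    show "1 - \<alpha> \<le> measure (?P d\<^sub>1 (S\<^sub>1 f)) {z \<in> space (data_space n p). real K\<^sub>1 * d\<^sub>1 * m \<le> u z}"
      by (rule cover) (use S1[OF f] T1[OF f] K in auto)
  qed (use d m in auto)
  then obtain f where f: "f \<in> F\<^sub>0" "ennreal (real K\<^sub>1 * d\<^sub>1 * m * (1 - 2 * \<alpha> - 2 * \<epsilon>))
      \<le> (\<integral>\<^sup>+z. ennreal (u z - l z) \<partial>?P d\<^sub>0 (S\<^sub>0 f))" by auto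
  have "(\<integral>\<^sup>+z. ennreal (u z - l z) \<partial>?P d\<^sub>0 (S\<^sub>0 f))
      \<le> (SUP \<theta>\<in>param_space p k\<^sub>1 (1\<^sub>m p) \<sigma>. \<integral>\<^sup>+z. ennreal (u z - l z) \<partial>data_law n p \<theta>)"
    using S0[OF f(1)] K by (intro SUP_upper2[OF in_space[of "S\<^sub>0 f" k\<^sub>1 d\<^sub>0]]) auto
  with f(2) show "ennreal (real K\<^sub>1 * d\<^sub>1 * m * (1 - 2 * \<alpha> - 2 * \<epsilon>))
      \<le> (SUP \<theta>\<in>param_space p k\<^sub>1 (1\<^sub>m p) \<sigma>. \<integral>\<^sup>+z. ennreal (u z - l z) \<partial>data_law n p \<theta>)"
    by (rule order_trans)
qed

text \<open>The dense regime at work: blocks have size about \<open>q / K\<close>, so two draws agree in about \<open>K\<^sup>2 / q\<close>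
  blocks. This is at most of order \<open>p powr (2\<gamma> - \<gamma>\<^sub>q)\<close>, and the gap between \<open>2\<gamma>\<close> and \<open>\<gamma>\<^sub>q\<close> pays for the price
  \<open>exp v \<le> p powr \<eta>\<close> of each agreement.\<close>

lemma agreement_factor_bound:
  fixes K q p :: nat
  assumes p: "1 \<le> p" and K: "1 \<le> K" "real K \<le> c * real p powr \<gamma>"
    and q: "c\<^sub>q / 2 * real p powr \<gamma>\<^sub>q \<le> real q" and c: "0 < c" "0 < c\<^sub>q" "2 * c\<^sup>2 \<le> c\<^sub>q"
    and v: "0 \<le> v" "v \<le> \<eta> * ln (real p)" and \<eta>: "0 \<le> \<eta>" "2 * \<gamma> + \<eta> \<le> \<gamma>\<^sub>q"
  shows "0 < q div K" and "(1 + (exp v - 1) / real (q div K)) ^ K \<le> exp (4 * c\<^sup>2 / c\<^sub>q)"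
proof -
  let ?B = "q div K"
  have p0: "0 < real p" "1 \<le> real p" using p by auto
  have "(real K)\<^sup>2 \<le> (c * real p powr \<gamma>)\<^sup>2" using K by (intro power_mono) auto
  also have "\<dots> = c\<^sup>2 * real p powr (2 * \<gamma>)"
    by (simp add: power_mult_distrib power2_eq_square flip: powr_add)
  finally have K2: "(real K)\<^sup>2 \<le> c\<^sup>2 * real p powr (2 * \<gamma>)" .
  have "real K \<le> (real K)\<^sup>2" using K by (simp add: power2_eq_square)
  also note K2
  also have "c\<^sup>2 * real p powr (2 * \<gamma>) \<le> c\<^sub>q / 2 * real p powr \<gamma>\<^sub>q"
    using c p0 \<eta> by (intro mult_mono powr_mono) auto
  also note q
  finally have Kq: "K \<le> q" by simp
  then show B: "0 < ?B" using K by (simp add: div_greater_zero_iff)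
  have "real q \<le> 2 * real K * real ?B"
  proof -
    have "q < K * (?B + 1)" using dividend_less_times_div[of K q] K by simp
    also have "\<dots> \<le> K * (2 * ?B)" using B by (intro mult_left_mono) auto
    finally have "real q \<le> real (K * (2 * ?B))" by linarith
    then show ?thesis by simp
  qed
  with q have qB: "c\<^sub>q / 2 * real p powr \<gamma>\<^sub>q \<le> 2 * real K * real ?B" by linarith
  have ev: "exp v \<le> real p powr \<eta>" using v p0 by (simp add: powr_def)
  have "real K * real p powr \<eta> * c\<^sub>q * real K \<le> 4 * c\<^sup>2 * real ?B * real K"
  proof -
    have "real K * real p powr \<eta> * c\<^sub>q * real K = (real K)\<^sup>2 * (real p powr \<eta> * c\<^sub>q)"
      by (simp add: power2_eq_square)
    also have "\<dots> \<le> c\<^sup>2 * real p powr (2 * \<gamma>) * (real p powr \<eta> * c\<^sub>q)"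
      using K2 c by (intro mult_right_mono) auto
    also have "\<dots> = c\<^sup>2 * c\<^sub>q * real p powr (2 * \<gamma> + \<eta>)" by (simp add: powr_add)
    also have "\<dots> \<le> c\<^sup>2 * c\<^sub>q * real p powr \<gamma>\<^sub>q"
      using c p0 \<eta> by (intro mult_left_mono powr_mono) auto
    also have "\<dots> = 2 * c\<^sup>2 * (c\<^sub>q / 2 * real p powr \<gamma>\<^sub>q)" by simp
    also have "\<dots> \<le> 2 * c\<^sup>2 * (2 * real K * real ?B)" using qB by (intro mult_left_mono) auto
    finally show ?thesis by (simp add: mult_ac)
  qed
  then have "real K * real p powr \<eta> \<le> 4 * c\<^sup>2 / c\<^sub>q * real ?B"
    using c K by (simp add: field_simps)
  moreover have "real K * (exp v - 1) \<le> real K * real p powr \<eta>"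
    using ev K by (intro mult_left_mono) auto
  ultimately have Ky: "real K * ((exp v - 1) / real ?B) \<le> 4 * c\<^sup>2 / c\<^sub>q"
    using B by (simp add: pos_divide_le_eq)
  have "(1 + (exp v - 1) / real ?B) ^ K \<le> exp ((exp v - 1) / real ?B) ^ K"
    using v by (intro power_mono exp_ge_add_one_self) (auto intro!: add_nonneg_nonneg)
  also have "\<dots> = exp (real K * ((exp v - 1) / real ?B))" by (rule exp_of_nat_mult[symmetric])
  also have "\<dots> \<le> exp (4 * c\<^sup>2 / c\<^sub>q)" using Ky by simp
  finally show "(1 + (exp v - 1) / real ?B) ^ K \<le> exp (4 * c\<^sup>2 / c\<^sub>q)" .
qed

lemma loadings_bounds:
  assumes "\<xi> \<in> loadings p q cbar" and "1 \<le> cbar"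
  obtains m where "0 \<le> m" "\<And>j. j \<in> supp_vec \<xi> \<Longrightarrow> m \<le> \<bar>vec_index \<xi> j\<bar>" "linf_norm \<xi> \<le> cbar * m"
proof -
  have \<xi>: "\<xi> \<in> carrier_vec p" "\<xi> \<noteq> 0\<^sub>v p"
    and ratio: "Max ((\<lambda>j. \<bar>vec_index \<xi> j\<bar>) ` supp_vec \<xi>) \<le> cbar * Min ((\<lambda>j. \<bar>vec_index \<xi> j\<bar>) ` supp_vec \<xi>)"
    using assms by (auto simp: loadings_def)
  define m where "m = Min ((\<lambda>j. \<bar>vec_index \<xi> j\<bar>) ` supp_vec \<xi>)"
  have ne: "supp_vec \<xi> \<noteq> {}"
  proof
    assume "supp_vec \<xi> = {}"
    then have "\<xi> = 0\<^sub>v p" using \<xi>(1) by (intro eq_vecI) (auto simp: supp_vec_def)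
    with \<xi>(2) show False by simp
  qed
  have m_le: "m \<le> \<bar>vec_index \<xi> j\<bar>" if "j \<in> supp_vec \<xi>" for j
    unfolding m_def using that finite_supp_vec by (intro Min_le) auto
  have "m \<in> (\<lambda>j. \<bar>vec_index \<xi> j\<bar>) ` supp_vec \<xi>"
    unfolding m_def using ne finite_supp_vec by (intro Min_in) auto
  then have m0: "0 \<le> m" by auto
  have dim: "{..<dim_vec \<xi>} \<noteq> {}" using ne by (auto simp: supp_vec_def)
  have "linf_norm \<xi> \<le> cbar * m"
    unfolding linf_norm_def
  proof (rule Max.boundedI)
    fix y assume "y \<in> (\<lambda>j. \<bar>vec_index \<xi> j\<bar>) ` {..<dim_vec \<xi>}"
    then obtain j where j: "j < dim_vec \<xi>" "y = \<bar>vec_index \<xi> j\<bar>" by auto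
    show "y \<le> cbar * m"
    proof (cases "j \<in> supp_vec \<xi>")
      case True
      then have "y \<le> Max ((\<lambda>j. \<bar>vec_index \<xi> j\<bar>) ` supp_vec \<xi>)"
        using finite_supp_vec j by (intro Max_ge) auto
      with ratio show ?thesis by (simp add: m_def)
    next
      case False
      then have "y = 0" using j by (simp add: supp_vec_def)
      then show ?thesis using m0 assms(2) by simp
    qed
  qed (use dim in auto)
  with m0 m_le show ?thesis by (rule that)
qed

theorem theorem8:
  fixes \<alpha> \<gamma> \<gamma>\<^sub>q c\<^sub>q \<sigma>\<^sub>0 cbar :: real
  assumes "0 < \<alpha>" and "\<alpha> < 1 / 2"
    and "0 \<le> \<gamma>" and "\<gamma> < 1 / 2"
    and "2 * \<gamma> < \<gamma>\<^sub>q" and "\<gamma>\<^sub>q \<le> 1"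
    and "0 < c\<^sub>q" and "0 < \<sigma>\<^sub>0" and "1 \<le> cbar"
  shows "\<exists>c c\<^sub>1 :: real. 0 < c \<and> 0 < c\<^sub>1 \<and>
    (\<forall>(n :: nat) (p :: nat) (k\<^sub>1 :: nat) (k :: nat) (q :: nat) (\<xi> :: real vec).
       1 \<le> k\<^sub>1 \<longrightarrow> k\<^sub>1 \<le> k \<longrightarrow>
       real k \<le> c * min (real p powr \<gamma>) (real n / ln (real p)) \<longrightarrow>
       \<bar>real q - c\<^sub>q * real p powr \<gamma>\<^sub>q\<bar> < 1 \<longrightarrow>
       \<xi> \<in> loadings p q cbar \<longrightarrow>
       ennreal (c\<^sub>1 * linf_norm \<xi> * \<sigma>\<^sub>0 *
         max (sqrt (real k * real k\<^sub>1) * sqrt (ln (real p) / real n))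
             (min (real k * sqrt (ln (real p) / real n))
                  (sqrt (real k) / real n powr (1 / 4))))
       \<le> opt_length n p \<alpha>
            (param_space p k\<^sub>1 (1\<^sub>m p) \<sigma>\<^sub>0) (param_space p k (1\<^sub>m p) \<sigma>\<^sub>0)
            (\<lambda>\<beta>. scalar_prod \<xi> \<beta>))"
proof -
  \<comment> \<open>Chosen so that \<open>1 - 2\<alpha> - 2\<epsilon> = (1 - 2\<alpha>) / 2\<close>.\<close>
  define \<epsilon> where "\<epsilon> = (1 - 2 * \<alpha>) / 4"
  have \<epsilon>: "0 < \<epsilon>" "\<epsilon> \<le> 1 / 4" using assms(1,2) by (auto simp: \<epsilon>_def)
  \<comment> \<open>The scale of the coefficients relative to \<open>\<sigma>\<^sub>0 sqrt (ln p / n)\<close>: an agreement costs \<open>p powr (2\<kappa>\<^sup>2)\<close>, which must fit into the gap \<open>\<gamma>\<^sub>q - 2\<gamma>\<close>; a variance mismatch costs \<open>exp (4\<kappa>^4)\<close>, which must be close to 1.\<close>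
  define \<kappa> where "\<kappa> = min (min (1 / 2) ((\<gamma>\<^sub>q - 2 * \<gamma>) / 2)) (\<epsilon> / 4)"
  have \<kappa>: "0 < \<kappa>" "\<kappa> \<le> 1 / 2" "\<kappa> \<le> (\<gamma>\<^sub>q - 2 * \<gamma>) / 2" "\<kappa> \<le> \<epsilon> / 4"
    using assms \<epsilon> by (auto simp: \<kappa>_def min_def)
  have \<kappa>\<kappa>: "\<kappa>\<^sup>2 \<le> \<kappa> / 2" using mult_left_mono[OF \<kappa>(2), of \<kappa>] \<kappa>(1) by (simp add: power2_eq_square)
  \<comment> \<open>Small enough for the number of agreements to be negligible, for \<open>k \<le> c p powr \<gamma>\<close> to force \<open>p powr \<gamma>\<close> to be large, and for \<open>k (ln p) / n\<close> to be at most 1.\<close>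
  define c where "c = min (min 1 (c\<^sub>q / 2)) (\<epsilon>\<^sup>2 * c\<^sub>q / 16)"
  have c: "0 < c" "c \<le> 1" "c \<le> c\<^sub>q / 2" "c \<le> \<epsilon>\<^sup>2 * c\<^sub>q / 16"
    using assms \<epsilon> by (auto simp: c_def)
  have cc: "c\<^sup>2 \<le> c" using mult_left_mono[OF c(2), of c] c(1) by (simp add: power2_eq_square)
  have total: "exp (4 * \<kappa> ^ 4) * exp (4 * c\<^sup>2 / c\<^sub>q) \<le> 1 + \<epsilon>\<^sup>2"
  proof -
    have "\<kappa> ^ 4 = (\<kappa>\<^sup>2)\<^sup>2" by (simp flip: power_mult)
    also have "\<dots> \<le> (\<epsilon> / 4)\<^sup>2" using \<kappa>\<kappa> \<kappa> by (intro power_mono) auto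
    finally have 1: "4 * \<kappa> ^ 4 \<le> \<epsilon>\<^sup>2 / 4" by (simp add: power_divide)
    have "4 * c\<^sup>2 \<le> \<epsilon>\<^sup>2 / 4 * c\<^sub>q" using cc c by linarith
    then have 2: "4 * c\<^sup>2 / c\<^sub>q \<le> \<epsilon>\<^sup>2 / 4" using assms by (simp add: pos_divide_le_eq)
    define x where "x = \<epsilon>\<^sup>2 / 2"
    have "\<epsilon>\<^sup>2 \<le> 1" using \<epsilon> by (simp add: power_le_one_iff)
    then have x: "0 \<le> x" "x \<le> 1" by (auto simp: x_def)
    have "exp (4 * \<kappa> ^ 4) * exp (4 * c\<^sup>2 / c\<^sub>q) \<le> exp x"
      using 1 2 by (simp add: x_def flip: exp_add)
    also have "\<dots> \<le> 1 + x + x\<^sup>2" using x by (rule exp_bound)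
    also have "\<dots> \<le> 1 + 2 * x" using mult_left_mono[OF x(2,1)] by (simp add: power2_eq_square)
    finally show ?thesis by (simp add: x_def)
  qed
  define c\<^sub>1 where "c\<^sub>1 = \<kappa> * (1 - 2 * \<alpha>) / (2 * cbar)"
  have c1: "0 < c\<^sub>1" using \<kappa> assms by (simp add: c\<^sub>1_def)
  have main: "ennreal (c\<^sub>1 * linf_norm \<xi> * \<sigma>\<^sub>0 *
         max (sqrt (real k * real k\<^sub>1) * sqrt (ln (real p) / real n))
             (min (real k * sqrt (ln (real p) / real n)) (sqrt (real k) / real n powr (1 / 4))))
       \<le> opt_length n p \<alpha> (param_space p k\<^sub>1 (1\<^sub>m p) \<sigma>\<^sub>0) (param_space p k (1\<^sub>m p) \<sigma>\<^sub>0) (\<lambda>\<beta>. scalar_prod \<xi> \<beta>)"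
    if k1: "1 \<le> k\<^sub>1" "k\<^sub>1 \<le> k" and k: "real k \<le> c * min (real p powr \<gamma>) (real n / ln (real p))"
      and q: "\<bar>real q - c\<^sub>q * real p powr \<gamma>\<^sub>q\<bar> < 1" and \<xi>: "\<xi> \<in> loadings p q cbar"
    for n p k\<^sub>1 k q :: nat and \<xi> :: "real vec"
  proof -
    have kpos: "1 \<le> real k" using k1 by simp
    have nln: "0 < real n / ln (real p)"
    proof (rule ccontr)
      assume "\<not> ?thesis"
      then have "c * min (real p powr \<gamma>) (real n / ln (real p)) \<le> 0"
        using c by (intro mult_nonneg_nonpos) auto
      with k kpos show False by linarith
    qed
    have p: "2 \<le> p"
    proof (rule ccontr)
      assume "\<not> 2 \<le> p"
      then have "p = 0 \<or> p = 1" by auto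
      with nln show False by auto
    qed
    have n: "0 < real n" using nln by (cases "n = 0") auto
    define L where "L = ln (real p)"
    have L: "0 < L" using p by (simp add: L_def)
    define \<tau> where "\<tau> = sqrt (L / real n)"
    have \<tau>: "0 < \<tau>" "\<tau>\<^sup>2 = L / real n" using L n by (auto simp: \<tau>_def)
    have k_p: "real k \<le> c * real p powr \<gamma>" and k_n: "real k \<le> c * (real n / L)"
      unfolding L_def using c(1) by (intro order_trans[OF k mult_left_mono], simp, simp)+
    have k\<tau>: "real k * \<tau>\<^sup>2 \<le> c" using k_n L n unfolding \<tau>(2) by (simp add: field_simps)
    have q_ge: "c\<^sub>q / 2 * real p powr \<gamma>\<^sub>q \<le> real q"
    proof -
      \<comment> \<open>The rounding of \<open>q\<close> is harmless, as \<open>c\<^sub>q p powr \<gamma>\<^sub>q \<ge> 2\<close>.\<close>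
      have "1 \<le> c * real p powr \<gamma>" using k_p kpos by linarith
      also have "\<dots> \<le> c\<^sub>q / 2 * real p powr \<gamma>\<^sub>q"
        using c p assms by (intro mult_mono powr_mono) auto
      finally show ?thesis using q by linarith
    qed
    have \<xi>c: "\<xi> \<in> carrier_vec p" and card: "card (supp_vec \<xi>) = q"
      using \<xi> by (auto simp: loadings_def l0_norm_def)
    obtain m where m: "0 \<le> m" "\<And>j. j \<in> supp_vec \<xi> \<Longrightarrow> m \<le> \<bar>vec_index \<xi> j\<bar>" and linf: "linf_norm \<xi> \<le> cbar * m"
      using loadings_bounds[OF \<xi> assms(9)] by metis
    have prior: "prior_hidden n (card (supp_vec \<xi>)) \<sigma>\<^sub>0 s \<epsilon> K d"
      if K: "1 \<le> K" "K \<le> k" and s: "\<sigma>\<^sub>0\<^sup>2 \<le> s\<^sup>2" and d: "d\<^sup>2 \<le> \<kappa>\<^sup>2 * \<sigma>\<^sub>0\<^sup>2 * \<tau>\<^sup>2"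
        and D: "\<bar>s\<^sup>2 - \<sigma>\<^sub>0\<^sup>2 - real K * d\<^sup>2\<bar> \<le> s\<^sup>2 / 4"
        and nD: "real n * ((s\<^sup>2 - \<sigma>\<^sub>0\<^sup>2 - real K * d\<^sup>2) / s\<^sup>2)\<^sup>2 \<le> \<kappa> ^ 4"
      for K d s
    proof -
      have s0: "0 < s\<^sup>2" using s assms(8) by (meson less_le_trans zero_less_power)
      have ds: "d\<^sup>2 \<le> \<kappa>\<^sup>2 * \<tau>\<^sup>2 * s\<^sup>2"
      proof -
        have "\<kappa>\<^sup>2 * \<tau>\<^sup>2 * \<sigma>\<^sub>0\<^sup>2 \<le> \<kappa>\<^sup>2 * \<tau>\<^sup>2 * s\<^sup>2" using s by (intro mult_left_mono) auto
        with d show ?thesis by (simp add: mult_ac)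
      qed
      have "real K * d\<^sup>2 \<le> real k * (\<kappa>\<^sup>2 * \<tau>\<^sup>2 * s\<^sup>2)" using K ds by (intro mult_mono) auto
      also have "\<dots> = (real k * \<tau>\<^sup>2) * \<kappa>\<^sup>2 * s\<^sup>2" by simp
      also have "\<dots> \<le> 1 * (1 / 2) * s\<^sup>2"
        using k\<tau> c \<kappa>\<kappa> \<kappa> by (intro mult_right_mono mult_mono) auto
      finally have small: "real K * d\<^sup>2 \<le> s\<^sup>2 / 2" by simp
      let ?v = "2 * real n * d\<^sup>2 / s\<^sup>2"
      have "d\<^sup>2 / s\<^sup>2 \<le> \<kappa>\<^sup>2 * \<tau>\<^sup>2" using ds s0 by (simp add: pos_divide_le_eq)
      then have "2 * real n * (d\<^sup>2 / s\<^sup>2) \<le> 2 * real n * (\<kappa>\<^sup>2 * \<tau>\<^sup>2)" by (intro mult_left_mono) auto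
      then have v: "0 \<le> ?v" "?v \<le> 2 * \<kappa>\<^sup>2 * ln (real p)" using n by (auto simp: \<tau>(2) L_def)
      have KP: "real K \<le> c * real p powr \<gamma>" using K k_p by linarith
      have p1: "1 \<le> p" and c2: "2 * c\<^sup>2 \<le> c\<^sub>q" and \<eta>: "0 \<le> 2 * \<kappa>\<^sup>2" "2 * \<gamma> + 2 * \<kappa>\<^sup>2 \<le> \<gamma>\<^sub>q"
        using p cc c \<kappa>\<kappa> \<kappa> by auto
      note ab = agreement_factor_bound[OF p1 K(1) KP q_ge c(1) assms(7) c2 v \<eta>]
      have "exp (4 * real n * ((s\<^sup>2 - \<sigma>\<^sub>0\<^sup>2 - real K * d\<^sup>2) / s\<^sup>2)\<^sup>2)
         * (1 + (exp ?v - 1) / real (q div K)) ^ K \<le> exp (4 * \<kappa> ^ 4) * exp (4 * c\<^sup>2 / c\<^sub>q)"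
        using nD ab(2) v by (intro mult_mono) (auto intro!: zero_le_power add_nonneg_nonneg)
      with total ab(1) small D show ?thesis unfolding card prior_hidden_def by linarith
    qed
    let ?X = "max (sqrt (real k * real k\<^sub>1) * \<tau>) (min (real k * \<tau>) (sqrt (real k) / real n powr (1 / 4)))"
    have X0: "0 \<le> ?X" using \<tau> by (simp add: le_max_iff_disj)
    have "ennreal (c\<^sub>1 * linf_norm \<xi> * \<sigma>\<^sub>0 * ?X) \<le> ennreal (\<kappa> * \<sigma>\<^sub>0 * ?X * m * (1 - 2 * \<alpha> - 2 * \<epsilon>))"
    proof (rule ennreal_leI)
      have "c\<^sub>1 * linf_norm \<xi> * \<sigma>\<^sub>0 * ?X \<le> c\<^sub>1 * (cbar * m) * \<sigma>\<^sub>0 * ?X"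
        using linf c1 X0 assms(8) by (intro mult_right_mono mult_left_mono) auto
      also have "\<dots> = \<kappa> * \<sigma>\<^sub>0 * ?X * m * (1 - 2 * \<alpha> - 2 * \<epsilon>)"
        using assms(9) by (simp add: c\<^sub>1_def \<epsilon>_def field_simps)
      finally show "c\<^sub>1 * linf_norm \<xi> * \<sigma>\<^sub>0 * ?X \<le> \<kappa> * \<sigma>\<^sub>0 * ?X * m * (1 - 2 * \<alpha> - 2 * \<epsilon>)" .
    qed
    also have "\<dots> \<le> opt_length n p \<alpha> (param_space p k\<^sub>1 (1\<^sub>m p) \<sigma>\<^sub>0) (param_space p k (1\<^sub>m p) \<sigma>\<^sub>0) (\<lambda>\<beta>. scalar_prod \<xi> \<beta>)"
    proof (cases "min (real k * \<tau>) (sqrt (real k) / real n powr (1 / 4)) \<le> sqrt (real k * real k\<^sub>1) * \<tau>")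
      case True
      \<comment> \<open>Both families carry the same total energy, so with \<open>s\<^sup>2\<close> the common variance of a response there is no mismatch.\<close>
      define d\<^sub>0 where "d\<^sub>0 = - (\<kappa> * \<sigma>\<^sub>0 * \<tau>)"
      define d\<^sub>1 where "d\<^sub>1 = \<kappa> * \<sigma>\<^sub>0 * \<tau> * sqrt (real k\<^sub>1 / real k)"
      define s where "s = sqrt (\<sigma>\<^sub>0\<^sup>2 + real k\<^sub>1 * d\<^sub>0\<^sup>2)"
      have s2: "s\<^sup>2 = \<sigma>\<^sub>0\<^sup>2 + real k\<^sub>1 * d\<^sub>0\<^sup>2" by (simp add: s_def)
      have s: "0 < s" using assms(8) by (simp add: s_def add_pos_nonneg)
      have d02: "d\<^sub>0\<^sup>2 = \<kappa>\<^sup>2 * \<sigma>\<^sub>0\<^sup>2 * \<tau>\<^sup>2" by (simp add: d\<^sub>0_def power_mult_distrib)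
      have d12: "d\<^sub>1\<^sup>2 = d\<^sub>0\<^sup>2 * (real k\<^sub>1 / real k)" by (simp add: d\<^sub>1_def d02 power_mult_distrib)
      have eq: "real k * d\<^sub>1\<^sup>2 = real k\<^sub>1 * d\<^sub>0\<^sup>2" using kpos by (simp add: d12)
      have "d\<^sub>0\<^sup>2 * (real k\<^sub>1 / real k) \<le> d\<^sub>0\<^sup>2 * 1" using k1 by (intro mult_left_mono) auto
      then have d1_le: "d\<^sub>1\<^sup>2 \<le> \<kappa>\<^sup>2 * \<sigma>\<^sub>0\<^sup>2 * \<tau>\<^sup>2" by (simp add: d12 d02)
      have X: "\<kappa> * \<sigma>\<^sub>0 * ?X = real k * d\<^sub>1"
      proof -
        have "real k * sqrt (real k\<^sub>1 / real k) = sqrt (real k * real k\<^sub>1)"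
          using kpos by (simp add: real_sqrt_divide real_sqrt_mult real_div_sqrt field_simps)
        with True show ?thesis by (simp add: d\<^sub>1_def max_absorb1 mult_ac)
      qed
      show ?thesis
        unfolding X
      proof (rule opt_length_two_priors[OF \<xi>c m assms(8) s \<epsilon>(1) order_refl k1(2) order_refl])
        show "d\<^sub>0 \<le> 0" "0 \<le> d\<^sub>1" using \<kappa> \<tau> assms(8) by (auto simp: d\<^sub>0_def d\<^sub>1_def)
        show "prior_hidden n (card (supp_vec \<xi>)) \<sigma>\<^sub>0 s \<epsilon> k\<^sub>1 d\<^sub>0"
          by (rule prior) (use k1 \<kappa> in \<open>auto simp: s2 d02\<close>)
        show "prior_hidden n (card (supp_vec \<xi>)) \<sigma>\<^sub>0 s \<epsilon> k d\<^sub>1"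
          by (rule prior) (use k1 d1_le eq \<kappa> in \<open>auto simp: s2\<close>)
      qed
    next
      case False
      \<comment> \<open>Pure noise against \<open>k\<close> coordinates whose energy \<open>k d\<^sub>1\<^sup>2\<close> is at most of order \<open>n powr (-1/2)\<close>: the mismatch is below what \<open>n\<close> observations can resolve.\<close>
      define \<mu> where "\<mu> = min \<tau> (1 / (sqrt (real k) * real n powr (1 / 4)))"
      define d\<^sub>1 where "d\<^sub>1 = \<kappa> * \<sigma>\<^sub>0 * \<mu>"
      have n4: "0 < real n powr (1 / 4)" "(real n powr (1 / 4))\<^sup>2 = sqrt (real n)"
        using n by (auto simp: powr_half_sqrt power2_eq_square simp flip: powr_add)
      have \<mu>: "0 \<le> \<mu>" "\<mu> \<le> \<tau>" "\<mu> \<le> 1 / (sqrt (real k) * real n powr (1 / 4))"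
        using \<tau> n4 kpos by (auto simp: \<mu>_def)
      have d12: "d\<^sub>1\<^sup>2 = \<kappa>\<^sup>2 * \<sigma>\<^sub>0\<^sup>2 * \<mu>\<^sup>2" by (simp add: d\<^sub>1_def power_mult_distrib)
      have \<mu>\<tau>: "\<mu>\<^sup>2 \<le> \<tau>\<^sup>2" using \<mu> by (intro power_mono) auto
      have k\<mu>: "real k * \<mu>\<^sup>2 \<le> 1 / sqrt (real n)"
      proof -
        have "\<mu>\<^sup>2 \<le> (1 / (sqrt (real k) * real n powr (1 / 4)))\<^sup>2" using \<mu> by (intro power_mono) auto
        also have "\<dots> = 1 / (real k * sqrt (real n))" by (simp add: power_divide power_mult_distrib n4)
        finally show ?thesis using kpos n by (simp add: field_simps)
      qed
      have k\<mu>1: "real k * \<mu>\<^sup>2 \<le> 1"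
        using mult_left_mono[OF \<mu>\<tau>, of "real k"] k\<tau> c by linarith
      have X: "\<kappa> * \<sigma>\<^sub>0 * ?X = real k * d\<^sub>1"
      proof -
        have "real k * (1 / (sqrt (real k) * real n powr (1 / 4))) = sqrt (real k) / real n powr (1 / 4)"
          using kpos n4 by (simp add: field_simps flip: real_sqrt_mult)
        then have "real k * \<mu> = min (real k * \<tau>) (sqrt (real k) / real n powr (1 / 4))"
          by (simp add: \<mu>_def min_mult_distrib_left)
        moreover have "?X = min (real k * \<tau>) (sqrt (real k) / real n powr (1 / 4))"
          using False by (intro max_absorb2) linarith
        ultimately show ?thesis by (simp only: d\<^sub>1_def) (simp add: mult_ac)
      qed
      have ratio: "(\<sigma>\<^sub>0\<^sup>2 - \<sigma>\<^sub>0\<^sup>2 - real k * d\<^sub>1\<^sup>2) / \<sigma>\<^sub>0\<^sup>2 = - (\<kappa>\<^sup>2 * (real k * \<mu>\<^sup>2))"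
        using assms(8) by (simp add: d12)
      have nD: "real n * ((\<sigma>\<^sub>0\<^sup>2 - \<sigma>\<^sub>0\<^sup>2 - real k * d\<^sub>1\<^sup>2) / \<sigma>\<^sub>0\<^sup>2)\<^sup>2 \<le> \<kappa> ^ 4"
      proof -
        have "(real k * \<mu>\<^sup>2)\<^sup>2 \<le> (1 / sqrt (real n))\<^sup>2" using k\<mu> by (intro power_mono) auto
        then have "real n * (real k * \<mu>\<^sup>2)\<^sup>2 \<le> 1" using n by (simp add: power_divide field_simps)
        then have "(\<kappa>\<^sup>2)\<^sup>2 * (real n * (real k * \<mu>\<^sup>2)\<^sup>2) \<le> (\<kappa>\<^sup>2)\<^sup>2 * 1" by (intro mult_left_mono) auto
        then show ?thesis unfolding ratio by (simp add: power_mult_distrib mult_ac flip: power_mult)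
      qed
      have "\<kappa>\<^sup>2 * (real k * \<mu>\<^sup>2) \<le> (1 / 4) * 1"
        using k\<mu>1 \<kappa>\<kappa> \<kappa> by (intro mult_mono) auto
      then have "\<kappa>\<^sup>2 * (real k * \<mu>\<^sup>2) * \<sigma>\<^sub>0\<^sup>2 \<le> 1 / 4 * \<sigma>\<^sub>0\<^sup>2" by (intro mult_right_mono) auto
      then have D: "\<bar>\<sigma>\<^sub>0\<^sup>2 - \<sigma>\<^sub>0\<^sup>2 - real k * d\<^sub>1\<^sup>2\<bar> \<le> \<sigma>\<^sub>0\<^sup>2 / 4"
        by (simp add: d12 mult_ac)
      have d1_le: "d\<^sub>1\<^sup>2 \<le> \<kappa>\<^sup>2 * \<sigma>\<^sub>0\<^sup>2 * \<tau>\<^sup>2"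
        unfolding d12 using \<mu>\<tau> by (intro mult_left_mono) auto
      show ?thesis
        unfolding X
      proof (rule opt_length_two_priors[OF \<xi>c m assms(8) assms(8) \<epsilon>(1) order_refl k1(2) order_refl])
        show "(0::real) \<le> 0" "0 \<le> d\<^sub>1" using \<kappa> \<mu> assms(8) by (auto simp: d\<^sub>1_def)
        show "prior_hidden n (card (supp_vec \<xi>)) \<sigma>\<^sub>0 \<sigma>\<^sub>0 \<epsilon> k\<^sub>1 0"
          by (rule prior) (use k1 \<kappa> in auto)
        show "prior_hidden n (card (supp_vec \<xi>)) \<sigma>\<^sub>0 \<sigma>\<^sub>0 \<epsilon> k d\<^sub>1"
          by (rule prior) (use k1 d1_le D nD in auto)
      qed
    qed
    finally show ?thesis by (simp add: \<tau>_def L_def)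
  qed
  show ?thesis
    by (intro exI[of _ c] exI[of _ c\<^sub>1] conjI c(1) c1 allI impI main)
qed

end
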